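(* Suppose the point-shift $\mathfrak H$ is bijective. Then $\mathfrak H$ preserves $\mathbf P^{\mathfrak m}$ if and only if $\mathfrak H$ is isomodular. That is, $\mathbf P^{\mathfrak m}(\theta_{\mathfrak h}^{-1}\in A)=\mathbf P^{\mathfrak m}(A)$ for all $A\in\mathcal A$ if and only if $\mathfrak H$ is isomodular.
   Context: $\mathbb X$ is a locally compact second-countable Hausdorff topological group (not necessarily unimodular) with neutral element $e$, Borel sets $\mathcal B(\mathbb X)$, a fixed left-invariant Haar measure $\lambda$, and modular function $\Delta:\mathbb X\to(0,\infty)$ given by $\lambda(Bx)=\Delta(x)\lambda(B)$ for all $B\in\mathcal B(\mathbb X)$. $(\Omega,\mathcal A,\theta,\mathbf P)$ is a stationary framework on $\mathbb X$: $(\Omega,\mathcal A,\mathbf P)$ is a probability space and $\theta:\mathbb X\times\Omega\to\Omega$, $\theta_x\omega:=\theta(x,\omega)$, is a (jointly) measurable left action of $\mathbb X$ preserving $\mathbf P$. $\mathfrak m$ is a simple point process (random locally finite counting measure on $\mathbb X$ with all atoms of mass $1$, identified with its support) that is flow-adapted: $\mathfrak m(\theta_x\omega,B)=\mathfrak m(\omega,x^{-1}B)$ for all $x\in\mathbb X,\omega\in\Omega,B\in\mathcal B(\mathbb X)$; its intensity $\gamma=\mathbf E[\mathfrak m(B)]/\lambda(B)$ (for any $B$ with $\lambda(B)\in(0,\infty)$) lies in $(0,\infty)$. The Palm probability measure is $\mathbf P^{\mathfrak m}(A):=\frac1\gamma\mathbf E\int_{\mathbb X}1_{\theta_x^{-1}\omega\in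 A}w(x)\,\mathfrak m(dx)$, for any measurable $w:\mathbb X\to[0,\infty)$ with $\int w\,d\lambda=1$. $\mathfrak H$ is a point-shift on $\mathfrak m$: a measurable map $\mathfrak H:\Omega\times\mathbb X\to\mathbb X$ such that for $\mathbf P$-a.e. $\omega$, $\mathfrak H(\omega,X)\in\mathfrak m(\omega)$ for all $X\in\mathfrak m(\omega)$, which is flow-adapted: $\mathfrak H(\theta_y\omega,yx)=y\mathfrak H(\omega,x)$ for all $x,y\in\mathbb X$, $\omega\in\Omega$ (with $\mathfrak H(\omega,x):=x$ for $x\notin\mathfrak m(\omega)$). Its point-map is $\mathfrak h(\omega):=\mathfrak H(\omega,e)$, and $\theta_{\mathfrak h}^{-1}$ denotes the map $\omega\mapsto\theta_{\mathfrak h(\omega)}^{-1}\omega$. $\mathfrak H$ is bijective if for $\mathbf P$-a.e. $\omega$, $\mathfrak H(\omega,\cdot)$ is a bijection of the support of $\mathfrak m(\omega)$. $\mathfrak H$ is isomodular if $\mathbf P$-a.s. $\Delta(X)=\Delta(\mathfrak H(X))$ for all $X\in\mathfrak m$. *)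

theory Defs
  imports "HOL-Probability.Probability"
begin

text \<open>
  The group is a type of class \<^class>\<open>topological_group_add\<close>, the library's class of
  topological groups. That class does not assume commutativity, so only the notation
  is additive: \<open>x + y\<close> is the product \<open>xy\<close>, \<open>- x\<close> is the inverse of \<open>x\<close>, and \<open>0\<close> is the neutral
  element.
\<close>

definition left_haar_measure ::
  "'x::{topological_group_add, second_countable_topology, t2_space} measure \<Rightarrow> bool" where
  "left_haar_measure L \<longleftrightarrow>
     sets L = sets borel \<and>
     emeasure L UNIV \<noteq> 0 \<and>
     (\<forall>K. compact K \<longrightarrow> emeasure L K < \<infinity>) \<and>
     (\<forall>x. \<forall>B\<in>sets borel. emeasure L ((\<lambda>b. x + b) ` B) = emeasure L B)"

definition modular_function ::
  "'x::{topological_group_add, second_countable_topology, t2_space} measure \<Rightarrow> ('x \<Rightarrow> real) \<Rightarrow> bool"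
where
  "modular_function L \<Delta> \<longleftrightarrow>
     (\<forall>x. 0 < \<Delta> x) \<and>
     (\<forall>x. \<forall>B\<in>sets borel. emeasure L ((\<lambda>b. b + x) ` B) = ennreal (\<Delta> x) * emeasure L B)"

definition stationary_framework ::
  "'w measure \<Rightarrow> ('x::{topological_group_add, second_countable_topology, t2_space} \<Rightarrow> 'w \<Rightarrow> 'w) \<Rightarrow> bool"
where
  "stationary_framework P \<theta> \<longleftrightarrow>
     prob_space P \<and>
     (\<lambda>(x, \<omega>). \<theta> x \<omega>) \<in> borel \<Otimes>\<^sub>M P \<rightarrow>\<^sub>M P \<and>
     (\<forall>\<omega>\<in>space P. \<theta> 0 \<omega> = \<omega>) \<and>
     (\<forall>x y. \<forall>\<omega>\<in>space P. \<theta> (x + y) \<omega> = \<theta> x (\<theta> y \<omega>)) \<and>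
     (\<forall>x. distr P P (\<theta> x) = P)"

definition counting_measure :: "'x::t2_space measure \<Rightarrow> bool" where
  "counting_measure \<mu> \<longleftrightarrow>
     sets \<mu> = sets borel \<and> (\<forall>B\<in>sets borel. emeasure \<mu> B \<in> insert \<infinity> (range of_nat))"

definition locally_finite_measure :: "'x::t2_space measure \<Rightarrow> bool" where
  "locally_finite_measure \<mu> \<longleftrightarrow> (\<forall>K. compact K \<longrightarrow> emeasure \<mu> K < \<infinity>)"

definition simple_point_process :: "'w measure \<Rightarrow> ('w \<Rightarrow> 'x::t2_space measure) \<Rightarrow> bool" where
  "simple_point_process P m \<longleftrightarrow>
     (\<forall>\<omega>\<in>space P. counting_measure (m \<omega>) \<and> locally_finite_measure (m \<omega>) \<and>
        (\<forall>x. emeasure (m \<omega>) {x} \<noteq> 0 \<longrightarrow> emeasure (m \<omega>) {x} = 1)) \<and>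
     (\<forall>B\<in>sets borel. (\<lambda>\<omega>. emeasure (m \<omega>) B) \<in> borel_measurable P)"

text \<open>The set of points with which a simple counting measure is identified.\<close>

definition supp :: "'x::t2_space measure \<Rightarrow> 'x set" where
  "supp \<mu> = {x. emeasure \<mu> {x} \<noteq> 0}"

definition flow_adapted_process ::
  "'w measure \<Rightarrow> ('x::{topological_group_add, second_countable_topology, t2_space} \<Rightarrow> 'w \<Rightarrow> 'w)
     \<Rightarrow> ('w \<Rightarrow> 'x measure) \<Rightarrow> bool" where
  "flow_adapted_process P \<theta> m \<longleftrightarrow>
     (\<forall>x. \<forall>\<omega>\<in>space P. \<forall>B\<in>sets borel.
        emeasure (m (\<theta> x \<omega>)) B = emeasure (m \<omega>) ((\<lambda>b. - x + b) ` B))"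

definition has_intensity ::
  "'w measure \<Rightarrow> 'x::{topological_group_add, second_countable_topology, t2_space} measure
     \<Rightarrow> ('w \<Rightarrow> 'x measure) \<Rightarrow> ennreal \<Rightarrow> bool" where
  "has_intensity P L m \<gamma> \<longleftrightarrow>
     (\<forall>B\<in>sets borel. 0 < emeasure L B \<and> emeasure L B < \<infinity> \<longrightarrow>
        \<gamma> = (\<integral>\<^sup>+ \<omega>. emeasure (m \<omega>) B \<partial>P) / emeasure L B)"

definition palm_prob ::
  "'w measure \<Rightarrow> ('x::{topological_group_add, second_countable_topology, t2_space} \<Rightarrow> 'w \<Rightarrow> 'w)
     \<Rightarrow> ('w \<Rightarrow> 'x measure) \<Rightarrow> ennreal \<Rightarrow> ('x \<Rightarrow> real) \<Rightarrow> 'w set \<Rightarrow> ennreal" where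
  "palm_prob P \<theta> m \<gamma> w A =
     1 / \<gamma> * (\<integral>\<^sup>+ \<omega>. (\<integral>\<^sup>+ x. indicator A (\<theta> (- x) \<omega>) * ennreal (w x) \<partial>m \<omega>) \<partial>P)"

definition point_shift ::
  "'w measure \<Rightarrow> ('x::{topological_group_add, second_countable_topology, t2_space} \<Rightarrow> 'w \<Rightarrow> 'w)
     \<Rightarrow> ('w \<Rightarrow> 'x measure) \<Rightarrow> ('w \<Rightarrow> 'x \<Rightarrow> 'x) \<Rightarrow> bool" where
  "point_shift P \<theta> m H \<longleftrightarrow>
     (\<lambda>(\<omega>, x). H \<omega> x) \<in> P \<Otimes>\<^sub>M borel \<rightarrow>\<^sub>M borel \<and>
     (AE \<omega> in P. \<forall>x\<in>supp (m \<omega>). H \<omega> x \<in> supp (m \<omega>)) \<and>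
     (\<forall>\<omega>\<in>space P. \<forall>x. x \<notin> supp (m \<omega>) \<longrightarrow> H \<omega> x = x) \<and>
     (\<forall>\<omega>\<in>space P. \<forall>x y. H (\<theta> y \<omega>) (y + x) = y + H \<omega> x)"

definition point_map :: "('w \<Rightarrow> 'x::zero \<Rightarrow> 'x) \<Rightarrow> 'w \<Rightarrow> 'x" where
  "point_map H \<omega> = H \<omega> 0"

definition bijective_shift :: "'w measure \<Rightarrow> ('w \<Rightarrow> 'x::t2_space measure) \<Rightarrow> ('w \<Rightarrow> 'x \<Rightarrow> 'x) \<Rightarrow> bool"
where
  "bijective_shift P m H \<longleftrightarrow> (AE \<omega> in P. bij_betw (H \<omega>) (supp (m \<omega>)) (supp (m \<omega>)))"

definition isomodular ::
  "'w measure \<Rightarrow> ('x::t2_space \<Rightarrow> real) \<Rightarrow> ('w \<Rightarrow> 'x measure) \<Rightarrow> ('w \<Rightarrow> 'x \<Rightarrow> 'x) \<Rightarrow> bool" where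
  "isomodular P \<Delta> m H \<longleftrightarrow> (AE \<omega> in P. \<forall>x\<in>supp (m \<omega>). \<Delta> x = \<Delta> (H \<omega> x))"

definition preserves_palm ::
  "'w measure \<Rightarrow> ('x::{topological_group_add, second_countable_topology, t2_space} \<Rightarrow> 'w \<Rightarrow> 'w)
     \<Rightarrow> ('w \<Rightarrow> 'x measure) \<Rightarrow> ennreal \<Rightarrow> ('x \<Rightarrow> real) \<Rightarrow> ('w \<Rightarrow> 'x \<Rightarrow> 'x) \<Rightarrow> bool" where
  "preserves_palm P \<theta> m \<gamma> w H \<longleftrightarrow>
     (\<forall>A\<in>sets P. palm_prob P \<theta> m \<gamma> w {\<omega>\<in>space P. \<theta> (- point_map H \<omega>) \<omega> \<in> A}
                 = palm_prob P \<theta> m \<gamma> w A)"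

end

theory Submission
  imports Defs
begin

text \<open>
  Palm measure and point-shift are studied through the Campbell measure \<open>campbell\<close> on pairs \<open>(\<omega>, x)\<close>, whose
  integral is the expected sum over the points \<open>x\<close> of \<open>m \<omega>\<close>. It is invariant under \<open>(\<omega>, x) \<mapsto> (\<theta> y \<omega>, y + x)\<close> by
  stationarity (\<open>campbell_flow\<close>) and under \<open>(\<omega>, x) \<mapsto> (\<omega>, H \<omega> x)\<close> because a bijection of the points permutes the
  summands (\<open>campbell_shift\<close>).

  In the coordinates \<open>(\<theta> (- x) \<omega>, x)\<close> the first symmetry acts by left translation of the second component only, so
  the uniqueness of Haar measure makes the Campbell measure a product of the unnormalised Palm measure \<open>Q\<close> and \<open>L\<close>
  (\<open>refined_campbell\<close>). With \<open>h = point_map H\<close> and \<open>\<tau> \<omega> = \<theta> (- h \<omega>) \<omega>\<close>, the second symmetry becomes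
  \<open>(\<omega>, x) \<mapsto> (\<tau> \<omega>, x + h \<omega>)\<close>. This is a right translation of the second component, which rescales \<open>L\<close> by a modulus;
  integrating that component out gives, for all \<open>f\<close>,
  \<open>\<integral> f dQ = \<integral> (f \<circ> \<tau>) * D dQ\<close> with \<open>D \<omega> = \<Delta> (- h \<omega>)\<close> (\<open>palm_change_of_variables\<close>).

  Seen from a point \<open>x\<close>, the value of \<open>D\<close> is \<open>\<Delta> x / \<Delta> (H \<omega> x)\<close>, so isomodularity means \<open>D = 1\<close> almost everywhere under \<open>Q\<close>
  (\<open>isomodular_iff_AE_palm\<close>), and then the displayed formula is the invariance of \<open>Q\<close> under \<open>\<tau>\<close>. For the converse, \<open>D\<close> is
  a function of \<open>\<tau>\<close>: by injectivity the origin is recovered from its image, and \<open>D = \<phi> \<circ> \<tau>\<close> where \<open>\<phi>\<close> is the modulus of the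
  preimage of the origin (\<open>incoming_modulus\<close>). If \<open>Q\<close> is invariant, then
  \<open>\<integral> f * \<phi> dQ = \<integral> (f \<circ> \<tau>) * D dQ = \<integral> f dQ\<close> for all \<open>f\<close>, hence \<open>\<phi> = 1\<close> and \<open>D = \<phi> \<circ> \<tau> = 1\<close> almost everywhere.
\<close>

section \<open>Exhaustion by compact sets\<close>

lemma compact_exhaustion:
  assumes "locally compact (UNIV :: 'x::second_countable_topology set)"
  obtains K :: "nat \<Rightarrow> 'x::second_countable_topology set" where "\<And>n. compact (K n)" "incseq K" "(\<Union>n. K n) = UNIV"
proof -
  have "\<exists>U V. open U \<and> compact V \<and> x \<in> U \<and> U \<subseteq> V" for x :: 'x
    using assms unfolding locally_def by (auto dest!: spec[of _ UNIV])
  then obtain U V where UV: "\<And>x::'x. open (U x)" "\<And>x. compact (V x)" "\<And>x. x \<in> U x" "\<And>x. U x \<subseteq> V x"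
    by metis
  obtain F where F: "F \<subseteq> range U" "countable F" "\<Union>F = \<Union>(range U)"
    using Lindelof_openin[of "range U" UNIV] UV(1) by (auto simp: image_iff)
  have cov: "\<Union>F = UNIV" using F(3) UV(3) by auto
  obtain I where I: "countable I" "F = U ` I"
    using F(1,2) by (meson countable_subset_image)
  have "I \<noteq> {}" using cov I(2) by auto
  define e where "e = from_nat_into I"
  have e: "range e = I"
    unfolding e_def using I(1) \<open>I \<noteq> {}\<close> by (rule range_from_nat_into[rotated])
  define K where "K n = (\<Union>i\<le>n. V (e i))" for n
  show ?thesis
  proof
    show "compact (K n)" for n unfolding K_def using UV(2) by auto
    show "incseq K" unfolding K_def by (auto simp: incseq_def intro: order_trans)
    have "x \<in> (\<Union>n. K n)" for x
    proof -
      obtain i where "i \<in> I" "x \<in> U i" using cov I(2) by blast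
      then obtain n where "i = e n" using e by blast
      then show ?thesis using \<open>x \<in> U i\<close> UV(4) unfolding K_def by blast
    qed
    then show "(\<Union>n. K n) = UNIV" by blast
  qed
qed

text \<open>
  This serves the Haar measure as well as the measures that are compared with it by uniqueness.
\<close>

lemma sigma_finite_if_finite_on_compacts:
  fixes M :: "'x::{second_countable_topology, t2_space} measure"
  assumes "locally compact (UNIV :: 'x set)" "sets M = sets borel"
    and "\<And>K. compact K \<Longrightarrow> emeasure M K < \<infinity>"
  shows "sigma_finite_measure M"
proof -
  obtain K :: "nat \<Rightarrow> 'x set" where K: "\<And>n. compact (K n)" "(\<Union>n. K n) = UNIV"
    using compact_exhaustion[OF assms(1)] by metis
  have "space M = UNIV" using sets_eq_imp_space_eq[OF assms(2)] by simp
  then show ?thesis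
    using K assms(2) borel_compact[OF K(1)] less_imp_neq[OF assms(3)[OF K(1)]]
    by (intro sigma_finite_measure.intro exI[of _ "range K"]) auto
qed

section \<open>Simple counting measures\<close>

lemma counting_measure_less_one:
  assumes "counting_measure \<mu>" "B \<in> sets borel" "emeasure \<mu> B < 1"
  shows "emeasure \<mu> B = 0"
proof -
  have "emeasure \<mu> B \<in> insert \<infinity> (range of_nat)" using assms by (auto simp: counting_measure_def)
  then consider "emeasure \<mu> B = \<infinity>" | n :: nat where "emeasure \<mu> B = of_nat n" by auto
  then show ?thesis
  proof cases
    case (2 n)
    then have "(of_nat n :: ennreal) < of_nat 1" using assms(3) by simp
    then have "n < 1" by (simp only: of_nat_less_iff)
    then show ?thesis using 2 by simp
  qed (use assms(3) in auto)
qed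

text \<open>
  Along a decreasing neighbourhood base the masses tend to the mass of the point, which is \<open>0\<close>; being
  integers, they are eventually equal to \<open>0\<close>.
\<close>

lemma null_nbhd_of_non_atom:
  fixes \<mu> :: "'x::{first_countable_topology, t2_space} measure"
  assumes "counting_measure \<mu>" "K \<in> sets borel" "emeasure \<mu> K < \<infinity>" "emeasure \<mu> {x} = 0"
  shows "\<exists>U. open U \<and> x \<in> U \<and> emeasure \<mu> (U \<inter> K) = 0"
proof -
  have [simp]: "sets \<mu> = sets borel" using assms(1) by (simp add: counting_measure_def)
  obtain X where X: "decseq X" "\<And>n. open (X n)" "\<And>n. x \<in> X n" "nhds x = (INF n. principal (X n))"
    using nhds_countable by blast
  have "(\<Inter>n. X n) = {x}"
  proof -
    have "\<exists>n. y \<notin> X n" if "y \<noteq> x" for y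
    proof -
      have "eventually (\<lambda>z. z \<noteq> y) (nhds x)"
        using that by (intro t1_space_nhds) auto
      moreover have "\<exists>k\<in>UNIV. principal (X k) \<le> inf (principal (X i)) (principal (X j))" for i j
        using decseqD[OF X(1)] by (intro bexI[of _ "max i j"]) auto
      ultimately obtain n where "\<forall>z\<in>X n. z \<noteq> y"
        unfolding X(4) by (subst (asm) eventually_INF_base) (auto simp: eventually_principal)
      then show ?thesis by blast
    qed
    then show ?thesis using X(3) by blast
  qed
  then have "(\<Inter>n. X n \<inter> K) \<subseteq> {x}" by auto
  then have null: "emeasure \<mu> (\<Inter>n. X n \<inter> K) = 0"
    using assms(4) emeasure_mono[of "(\<Inter>n. X n \<inter> K)" "{x}" \<mu>] by simp
  have "emeasure \<mu> (X n \<inter> K) \<noteq> \<infinity>" for n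
    using emeasure_mono[of "X n \<inter> K" K \<mu>] assms(2,3) by (auto simp: top_unique)
  moreover have "range (\<lambda>n. X n \<inter> K) \<subseteq> sets \<mu>" using X(2) assms(2) by auto
  moreover have "decseq (\<lambda>n. X n \<inter> K)" using X(1) by (auto simp: decseq_def)
  ultimately have "(\<lambda>n. emeasure \<mu> (X n \<inter> K)) \<longlonglongrightarrow> emeasure \<mu> (\<Inter>n. X n \<inter> K)"
    by (intro Lim_emeasure_decseq)
  then have "eventually (\<lambda>n. emeasure \<mu> (X n \<inter> K) < 1) sequentially"
    unfolding null by (rule order_tendstoD) simp
  then obtain n where "emeasure \<mu> (X n \<inter> K) < 1" by (auto simp: eventually_sequentially)
  then have "emeasure \<mu> (X n \<inter> K) = 0"
    by (rule counting_measure_less_one[OF assms(1), rotated]) (use X(2) assms(2) in auto)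
  then show ?thesis using X by blast
qed

text \<open>
  An integer-valued locally finite measure has no diffuse part: inside a compact set the non-atoms are
  covered by null open sets, and by the Lindeloef property countably many of these suffice.
\<close>

lemma counting_measure_AE_supp:
  fixes \<mu> :: "'x::{second_countable_topology, t2_space} measure"
  assumes "locally compact (UNIV :: 'x set)" "counting_measure \<mu>" "locally_finite_measure \<mu>"
  shows "AE x in \<mu>. x \<in> supp \<mu>"
proof -
  have sets[simp]: "sets \<mu> = sets borel" using assms(2) by (simp add: counting_measure_def)
  obtain K :: "nat \<Rightarrow> 'x set" where K: "\<And>n. compact (K n)" "(\<Union>n. K n) = UNIV"
    using compact_exhaustion[OF assms(1)] by metis
  have Kb: "K n \<in> sets borel" for n using borel_compact[OF K(1)] .
  have "AE x in \<mu>. x \<in> K n \<longrightarrow> x \<in> supp \<mu>" for n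
  proof -
    let ?F = "{U. open U \<and> emeasure \<mu> (U \<inter> K n) = 0}"
    obtain F where F: "F \<subseteq> ?F" "countable F" "\<Union>F = \<Union>?F"
      using Lindelof_openin[of ?F UNIV] by auto
    have "emeasure \<mu> (K n) < \<infinity>" using assms(3) K(1) by (auto simp: locally_finite_measure_def)
    then have "x \<in> \<Union>F" if "x \<notin> supp \<mu>" for x
      using null_nbhd_of_non_atom[OF assms(2) Kb, of n x] that unfolding F(3) by (auto simp: supp_def)
    moreover have "(\<Union>U\<in>F. U \<inter> K n) \<in> null_sets \<mu>"
      using F(1,2) Kb by (intro null_sets_UN') (auto simp: null_sets_def)
    ultimately show ?thesis by (intro AE_I'[of "\<Union>U\<in>F. U \<inter> K n"]) auto
  qed
  then have "AE x in \<mu>. \<forall>n. x \<in> K n \<longrightarrow> x \<in> supp \<mu>" by (subst AE_all_countable) blast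
  then show ?thesis by eventually_elim (use K(2) in blast)
qed

text \<open>
  The exceptional set need not be measurable: a null set contains no atom, and almost every point
  is an atom.
\<close>

lemma counting_measure_AE_iff:
  fixes \<mu> :: "'x::{second_countable_topology, t2_space} measure"
  assumes "locally compact (UNIV :: 'x set)" "counting_measure \<mu>" "locally_finite_measure \<mu>"
  shows "(AE x in \<mu>. R x) \<longleftrightarrow> (\<forall>x\<in>supp \<mu>. R x)"
proof
  have sets[simp]: "sets \<mu> = sets borel" using assms(2) by (simp add: counting_measure_def)
  have sp: "space \<mu> = UNIV" using sets_eq_imp_space_eq[OF sets] by simp
  assume "AE x in \<mu>. R x"
  then obtain N where N: "{x. \<not> R x} \<subseteq> N" "N \<in> sets \<mu>" "emeasure \<mu> N = 0"
    by (auto elim!: AE_E simp: sp)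
  show "\<forall>x\<in>supp \<mu>. R x"
  proof (intro ballI, rule ccontr)
    fix x assume "x \<in> supp \<mu>" "\<not> R x"
    then have "emeasure \<mu> {x} \<le> emeasure \<mu> N" using N by (intro emeasure_mono) auto
    with \<open>x \<in> supp \<mu>\<close> N(3) show False by (simp add: supp_def)
  qed
next
  assume "\<forall>x\<in>supp \<mu>. R x"
  with counting_measure_AE_supp[OF assms] show "AE x in \<mu>. R x" by auto
qed

lemma countable_supp:
  fixes \<mu> :: "'x::{second_countable_topology, t2_space} measure"
  assumes "locally compact (UNIV :: 'x set)" "counting_measure \<mu>" "locally_finite_measure \<mu>"
  shows "countable (supp \<mu>)"
proof -
  have sets[simp]: "sets \<mu> = sets borel" using assms(2) by (simp add: counting_measure_def)
  obtain K :: "nat \<Rightarrow> 'x set" where K: "\<And>n. compact (K n)" "(\<Union>n. K n) = UNIV"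
    using compact_exhaustion[OF assms(1)] by metis
  have "countable {x. measure (density \<mu> (indicator (K n))) {x} \<noteq> 0}" for n
  proof (rule finite_measure.countable_support)
    have "emeasure \<mu> (K n) < \<infinity>" using assms(3) K(1) by (auto simp: locally_finite_measure_def)
    moreover have "emeasure (density \<mu> (indicator (K n))) UNIV = emeasure \<mu> (K n)"
      using borel_compact[OF K(1), of n]
      by (subst emeasure_density) (auto intro!: borel_measurable_indicator)
    ultimately show "finite_measure (density \<mu> (indicator (K n)))"
      using sets_eq_imp_space_eq[OF sets] by (intro finite_measureI) auto
  qed
  then have "countable (\<Union>n. {x. measure (density \<mu> (indicator (K n))) {x} \<noteq> 0})" by auto
  moreover have "supp \<mu> \<subseteq> (\<Union>n. {x. measure (density \<mu> (indicator (K n))) {x} \<noteq> 0})"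
  proof
    fix x assume x: "x \<in> supp \<mu>"
    obtain n where n: "x \<in> K n" using K(2) by blast
    have "emeasure \<mu> (K n) < \<infinity>" using assms(3) K(1) by (auto simp: locally_finite_measure_def)
    moreover have "emeasure \<mu> {x} \<le> emeasure \<mu> (K n)"
      using n borel_compact[OF K(1)] by (intro emeasure_mono) auto
    moreover have "emeasure (density \<mu> (indicator (K n))) {x} = emeasure \<mu> {x}"
    proof -
      have "emeasure (density \<mu> (indicator (K n))) {x} = (\<integral>\<^sup>+ y. indicator {x} y \<partial>\<mu>)"
        using borel_compact[OF K(1), of n] n
        by (subst emeasure_density)
          (auto intro!: nn_integral_cong borel_measurable_indicator split: split_indicator)
      then show ?thesis by simp
    qed
    ultimately have "measure (density \<mu> (indicator (K n))) {x} \<noteq> 0"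
      using x by (simp add: measure_def supp_def enn2real_eq_0_iff)
    then show "x \<in> (\<Union>n. {x. measure (density \<mu> (indicator (K n))) {x} \<noteq> 0})" by blast
  qed
  ultimately show ?thesis by (rule countable_subset[rotated])
qed

text \<open>
  A simple counting measure is determined by its support. Integrals against it become sums, on which a
  bijection of the support acts by reindexing.
\<close>

lemma simple_counting_measure_eq:
  fixes \<mu> :: "'x::{second_countable_topology, t2_space} measure"
  assumes "locally compact (UNIV :: 'x set)" "counting_measure \<mu>" "locally_finite_measure \<mu>"
    and "\<And>x. emeasure \<mu> {x} \<noteq> 0 \<Longrightarrow> emeasure \<mu> {x} = 1"
  shows "\<mu> = distr (count_space (supp \<mu>)) borel (\<lambda>x. x)"
proof (rule measure_eqI)
  have sets[simp]: "sets \<mu> = sets borel" using assms(2) by (simp add: counting_measure_def)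
  show "sets \<mu> = sets (distr (count_space (supp \<mu>)) borel (\<lambda>x. x))" by simp
  fix B assume "B \<in> sets \<mu>"
  then have B: "B \<in> sets borel" by simp
  have cnt: "countable (supp \<mu>)" using countable_supp[OF assms(1-3)] .
  have S: "supp \<mu> \<in> sets borel"
  proof -
    have "(\<Union>x\<in>supp \<mu>. {x}) \<in> sets borel" using cnt by (intro sets.countable_UN') auto
    then show ?thesis by simp
  qed
  have "emeasure \<mu> B = emeasure \<mu> (B \<inter> supp \<mu>)"
    using counting_measure_AE_supp[OF assms(1-3)] B S by (intro emeasure_eq_AE) auto
  also have "\<dots> = (\<integral>\<^sup>+ x. emeasure \<mu> {x} \<partial>count_space (B \<inter> supp \<mu>))"
    using cnt by (intro emeasure_countable_singleton) auto
  also have "\<dots> = (\<integral>\<^sup>+ x. 1 \<partial>count_space (B \<inter> supp \<mu>))"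
    using assms(4) by (intro nn_integral_cong) (auto simp: supp_def)
  also have "\<dots> = emeasure (count_space (supp \<mu>)) (B \<inter> supp \<mu>)"
    by (simp add: emeasure_count_space)
  also have "\<dots> = emeasure (distr (count_space (supp \<mu>)) borel (\<lambda>x. x)) B"
    using B by (subst emeasure_distr) auto
  finally show "emeasure \<mu> B = emeasure (distr (count_space (supp \<mu>)) borel (\<lambda>x. x)) B" .
qed

lemma nn_integral_simple_counting_measure:
  fixes \<mu> :: "'x::{second_countable_topology, t2_space} measure"
  assumes "locally compact (UNIV :: 'x set)" "counting_measure \<mu>" "locally_finite_measure \<mu>"
    and "\<And>x. emeasure \<mu> {x} \<noteq> 0 \<Longrightarrow> emeasure \<mu> {x} = 1"
    and "f \<in> borel_measurable borel"
  shows "(\<integral>\<^sup>+ x. f x \<partial>\<mu>) = (\<integral>\<^sup>+ x. f x \<partial>count_space (supp \<mu>))"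
  using assms(5) by (subst simple_counting_measure_eq[OF assms(1-4)]) (simp_all add: nn_integral_distr)

section \<open>Haar measure\<close>

lemma borel_measurable_uminus_group [measurable (raw)]:
  fixes f :: "'a \<Rightarrow> 'x::{topological_group_add, second_countable_topology}"
  assumes "f \<in> borel_measurable M"
  shows "(\<lambda>x. - f x) \<in> borel_measurable M"
  using assms
  by (rule borel_measurable_continuous_on[rotated]) (intro continuous_intros)

lemma borel_measurable_diff_group [measurable (raw)]:
  fixes f g :: "'a \<Rightarrow> 'x::{topological_group_add, second_countable_topology}"
  assumes [measurable]: "f \<in> borel_measurable M" "g \<in> borel_measurable M"
  shows "(\<lambda>x. f x - g x) \<in> borel_measurable M"
  unfolding diff_conv_add_uminus by measurable

locale haar =
  fixes L :: "'x::{topological_group_add, second_countable_topology, t2_space} measure"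
    and \<Delta> :: "'x \<Rightarrow> real"
  assumes locally_compact: "locally compact (UNIV :: 'x set)"
    and haar: "left_haar_measure L"
    and modular: "modular_function L \<Delta>"
begin

lemma sets_L [simp, measurable_cong]: "sets L = sets borel"
  using haar by (simp add: left_haar_measure_def)

lemma space_L [simp]: "space L = UNIV"
  using sets_eq_imp_space_eq[OF sets_L] by simp

lemma modular_pos [simp]: "0 < \<Delta> x"
  using modular by (simp add: modular_function_def)

lemma modular_nonzero [simp]: "\<Delta> x \<noteq> 0"
  using modular_pos[of x] by linarith

lemma sigma_finite_L: "sigma_finite_measure L"
  using haar by (intro sigma_finite_if_finite_on_compacts locally_compact) (auto simp: left_haar_measure_def)

lemma ex_compact_positive: "\<exists>C. compact C \<and> 0 < emeasure L C"
proof -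
  obtain K :: "nat \<Rightarrow> 'x set" where K: "\<And>n. compact (K n)" "(\<Union>n. K n) = UNIV"
    using compact_exhaustion[OF locally_compact] by metis
  have "\<exists>n. emeasure L (K n) \<noteq> 0"
  proof (rule ccontr)
    assume "\<not> ?thesis"
    then have "(\<Union>n. K n) \<in> null_sets L"
      using borel_compact[OF K(1)] by (intro null_sets_UN) (auto simp: null_sets_def)
    then show False using haar K(2) by (auto simp: left_haar_measure_def)
  qed
  then show ?thesis using K(1) by (auto simp: zero_less_iff_neq_zero)
qed

lemma emeasure_compact_finite: "compact C \<Longrightarrow> emeasure L C < \<infinity>"
  using haar by (simp add: left_haar_measure_def)

lemma ex_finite_positive: "\<exists>B\<in>sets borel. 0 < emeasure L B \<and> emeasure L B < \<infinity>"
  using ex_compact_positive emeasure_compact_finite borel_compact by metis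

lemma distr_left: "distr L borel ((+) y) = L"
proof (rule measure_eqI)
  fix B assume "B \<in> sets (distr L borel ((+) y))"
  then have B[measurable]: "B \<in> sets borel" by simp
  have "(+) y -` B = (\<lambda>b. - y + b) ` B"
    by (auto simp: image_iff add.assoc[symmetric] intro!: bexI[of _ "y + _"])
  then show "emeasure (distr L borel ((+) y)) B = emeasure L B"
    using haar by (simp add: emeasure_distr left_haar_measure_def)
qed simp

text \<open>
  The modulus appears at \<open>- x\<close> because the preimage under the right translation by \<open>x\<close> is the right
  translate by \<open>- x\<close>.
\<close>

lemma emeasure_right:
  assumes [measurable]: "B \<in> sets borel"
  shows "emeasure L ((\<lambda>y. y + x) -` B) = ennreal (\<Delta> (- x)) * emeasure L B"
proof -
  have "(\<lambda>y. y + x) -` B = (\<lambda>b. b + - x) ` B"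
    by (auto simp: image_iff add.assoc intro!: bexI[of _ "_ + x"])
  then show ?thesis using modular assms unfolding modular_function_def by metis
qed

lemma nn_integral_right:
  assumes [measurable]: "f \<in> borel_measurable borel"
  shows "(\<integral>\<^sup>+ y. f (y + x) \<partial>L) = ennreal (\<Delta> (- x)) * (\<integral>\<^sup>+ y. f y \<partial>L)"
proof -
  have "distr L borel (\<lambda>y. y + x) = scale_measure (ennreal (\<Delta> (- x))) L"
    by (rule measure_eqI) (simp_all add: emeasure_distr emeasure_right)
  then have "(\<integral>\<^sup>+ y. f y \<partial>distr L borel (\<lambda>y. y + x)) = ennreal (\<Delta> (- x)) * (\<integral>\<^sup>+ y. f y \<partial>L)"
    by (simp add: nn_integral_scale_measure)
  then show ?thesis by (simp add: nn_integral_distr)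
qed

lemma modular_mult: "\<Delta> (x + y) = \<Delta> x * \<Delta> y"
proof -
  obtain B where B: "B \<in> sets borel" "0 < emeasure L B" "emeasure L B < \<infinity>"
    using ex_finite_positive by blast
  have *: "emeasure L ((\<lambda>b. b + z) ` C) = ennreal (\<Delta> z) * emeasure L C" if "C \<in> sets borel" for z C
    using modular that by (simp add: modular_function_def)
  have "(\<lambda>b. b + x) ` B = (\<lambda>b. b + - x) -` B"
    by (auto simp: image_iff add.assoc intro!: bexI[of _ "_ - x"])
  moreover have "(\<lambda>b. b + - x) -` B \<in> sets borel"
    using B(1) by (rule measurable_sets_borel[rotated]) simp
  ultimately have Bx: "(\<lambda>b. b + x) ` B \<in> sets borel" by simp
  have "ennreal (\<Delta> (x + y)) * emeasure L B = emeasure L ((\<lambda>b. b + (x + y)) ` B)"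
    using *[OF B(1)] by simp
  also have "\<dots> = emeasure L ((\<lambda>b. b + y) ` ((\<lambda>b. b + x) ` B))"
    by (simp add: image_image add.assoc)
  also have "\<dots> = ennreal (\<Delta> y) * (ennreal (\<Delta> x) * emeasure L B)"
    using *[OF Bx] *[OF B(1)] by simp
  also have "\<dots> = ennreal (\<Delta> x * \<Delta> y) * emeasure L B"
    by (simp add: ennreal_mult less_imp_le mult_ac)
  finally have "ennreal (\<Delta> (x + y)) = ennreal (\<Delta> x * \<Delta> y)"
    using B(2,3) by (subst (asm) (1 2) mult.commute, subst (asm) ennreal_mult_cancel_left) auto
  then show ?thesis by (simp add: less_imp_le)
qed

lemma modular_zero [simp]: "\<Delta> 0 = 1"
  using modular_mult[of 0 0] modular_pos[of 0] by simp

lemma modular_minus: "\<Delta> (- x) = 1 / \<Delta> x"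
  using modular_mult[of x "- x"] by (simp add: field_simps)

text \<open>
  The function \<open>\<Delta>\<close> is defined pointwise only. For a fixed set \<open>B\<close> of positive finite measure it is the
  quotient of the measures of \<open>B + x\<close> and \<open>B\<close>, and the numerator is measurable in \<open>x\<close> by Tonelli.
\<close>

lemma measurable_modular [measurable]: "\<Delta> \<in> borel_measurable borel"
proof -
  interpret sigma_finite_measure L by (rule sigma_finite_L)
  obtain B where B[measurable]: "B \<in> sets borel" and B': "0 < emeasure L B" "emeasure L B < \<infinity>"
    using ex_finite_positive by blast
  have eq: "\<Delta> = (\<lambda>x. enn2real (\<integral>\<^sup>+ y. indicator B (y + - x) \<partial>L) / enn2real (emeasure L B))"
  proof
    fix x
    have "(\<integral>\<^sup>+ y. indicator B (y + - x) \<partial>L) = ennreal (\<Delta> x) * emeasure L B"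
      by (subst nn_integral_right) auto
    then have "enn2real (\<integral>\<^sup>+ y. indicator B (y + - x) \<partial>L) = \<Delta> x * enn2real (emeasure L B)"
      by (simp add: enn2real_mult less_imp_le)
    moreover have "enn2real (emeasure L B) \<noteq> 0"
      using B' by (auto simp: enn2real_eq_0_iff)
    ultimately show "\<Delta> x = enn2real (\<integral>\<^sup>+ y. indicator B (y + - x) \<partial>L) / enn2real (emeasure L B)" by simp
  qed
  show ?thesis by (subst eq) measurable
qed

text \<open>
  The double integral of \<open>g x * \<Delta> x * k (y + x)\<close> is evaluated in two ways. Integrating over \<open>y\<close> first, the
  right translation by \<open>x\<close> cancels \<open>\<Delta> x\<close> and leaves the product on the left. Shifting \<open>x\<close> by \<open>- y\<close> under \<open>\<mu>\<close>
  and then \<open>y\<close> by \<open>x\<close> under \<open>L\<close> turns \<open>y + x\<close> into \<open>x\<close> and \<open>x\<close> into \<open>- y\<close>, and leaves the product on the right.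
\<close>

lemma left_invariant_swap:
  assumes "sigma_finite_measure \<mu>" and sets[measurable_cong]: "sets \<mu> = sets borel"
    and inv: "\<And>y. distr \<mu> borel ((+) y) = \<mu>"
    and [measurable]: "g \<in> borel_measurable borel" "k \<in> borel_measurable borel"
  shows "(\<integral>\<^sup>+ x. g x \<partial>\<mu>) * (\<integral>\<^sup>+ x. k x \<partial>L) = (\<integral>\<^sup>+ x. k x \<partial>\<mu>) * (\<integral>\<^sup>+ y. g (- y) * ennreal (\<Delta> (- y)) \<partial>L)"
proof -
  interpret L: sigma_finite_measure L by (rule sigma_finite_L)
  interpret \<mu>: sigma_finite_measure \<mu> by fact
  interpret pair_sigma_finite \<mu> L ..
  have shift_L: "(\<integral>\<^sup>+ y. f (z + y) \<partial>L) = (\<integral>\<^sup>+ y. f y \<partial>L)" if "f \<in> borel_measurable borel" for f :: "'x \<Rightarrow> ennreal" and z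
    using that by (subst (2) distr_left[of z, symmetric]) (simp add: nn_integral_distr)
  have shift_\<mu>: "(\<integral>\<^sup>+ y. f (z + y) \<partial>\<mu>) = (\<integral>\<^sup>+ y. f y \<partial>\<mu>)" if "f \<in> borel_measurable borel" for f :: "'x \<Rightarrow> ennreal" and z
    using that by (subst (2) inv[of z, symmetric]) (simp add: nn_integral_distr)
  have unit: "ennreal (\<Delta> x) * ennreal (\<Delta> (- x)) = 1" for x
    by (simp add: ennreal_mult'[symmetric] modular_minus less_imp_le)
  have "(\<integral>\<^sup>+ x. g x \<partial>\<mu>) * (\<integral>\<^sup>+ y. k y \<partial>L) = (\<integral>\<^sup>+ x. g x * (\<integral>\<^sup>+ y. k y \<partial>L) \<partial>\<mu>)"
    by (simp add: nn_integral_multc)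
  also have "\<dots> = (\<integral>\<^sup>+ x. \<integral>\<^sup>+ y. g x * ennreal (\<Delta> x) * k (y + x) \<partial>L \<partial>\<mu>)"
  proof (intro nn_integral_cong)
    fix x
    have "(\<integral>\<^sup>+ y. g x * ennreal (\<Delta> x) * k (y + x) \<partial>L) = g x * (ennreal (\<Delta> x) * ennreal (\<Delta> (- x))) * (\<integral>\<^sup>+ y. k y \<partial>L)"
      by (subst nn_integral_cmult) (simp_all add: nn_integral_right mult.assoc)
    then show "g x * (\<integral>\<^sup>+ y. k y \<partial>L) = (\<integral>\<^sup>+ y. g x * ennreal (\<Delta> x) * k (y + x) \<partial>L)"
      by (simp add: unit)
  qed
  also have "\<dots> = (\<integral>\<^sup>+ y. \<integral>\<^sup>+ x. g x * ennreal (\<Delta> x) * k (y + x) \<partial>\<mu> \<partial>L)"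
    by (intro Fubini'[symmetric]) measurable
  also have "\<dots> = (\<integral>\<^sup>+ y. \<integral>\<^sup>+ x. g (- y + x) * ennreal (\<Delta> (- y + x)) * k x \<partial>\<mu> \<partial>L)"
  proof (rule nn_integral_cong)
    fix y
    show "(\<integral>\<^sup>+ x. g x * ennreal (\<Delta> x) * k (y + x) \<partial>\<mu>) = (\<integral>\<^sup>+ x. g (- y + x) * ennreal (\<Delta> (- y + x)) * k x \<partial>\<mu>)"
      using shift_\<mu>[of "\<lambda>x. g (- y + x) * ennreal (\<Delta> (- y + x)) * k x" y]
      by (simp add: add.assoc[symmetric])
  qed
  also have "\<dots> = (\<integral>\<^sup>+ x. \<integral>\<^sup>+ y. g (- y + x) * ennreal (\<Delta> (- y + x)) * k x \<partial>L \<partial>\<mu>)"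
    by (intro Fubini') measurable
  also have "\<dots> = (\<integral>\<^sup>+ x. k x * (\<integral>\<^sup>+ y. g (- y) * ennreal (\<Delta> (- y)) \<partial>L) \<partial>\<mu>)"
  proof (intro nn_integral_cong)
    fix x
    have "(\<integral>\<^sup>+ y. g (- y + x) * ennreal (\<Delta> (- y + x)) * k x \<partial>L) = (\<integral>\<^sup>+ y. k x * (g (- y) * ennreal (\<Delta> (- y))) \<partial>L)"
      using shift_L[of "\<lambda>y. g (- y + x) * ennreal (\<Delta> (- y + x)) * k x" x]
      by (simp add: minus_add add.assoc mult_ac)
    then show "(\<integral>\<^sup>+ y. g (- y + x) * ennreal (\<Delta> (- y + x)) * k x \<partial>L) = k x * (\<integral>\<^sup>+ y. g (- y) * ennreal (\<Delta> (- y)) \<partial>L)"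
      by (simp add: nn_integral_cmult)
  qed
  also have "\<dots> = (\<integral>\<^sup>+ x. k x \<partial>\<mu>) * (\<integral>\<^sup>+ y. g (- y) * ennreal (\<Delta> (- y)) \<partial>L)"
    by (simp add: nn_integral_multc)
  finally show ?thesis .
qed

text \<open>
  Uniqueness of Haar measure, in a form without division. The last factor in \<open>left_invariant_swap\<close> does
  not depend on \<open>\<mu>\<close>; the choice \<open>\<mu> = L\<close> identifies it as the integral of \<open>g\<close> under \<open>L\<close>.
\<close>

theorem left_invariant_unique:
  assumes "sigma_finite_measure \<mu>" "sets \<mu> = sets borel" "\<And>y. distr \<mu> borel ((+) y) = \<mu>"
    and [measurable]: "g \<in> borel_measurable borel" "k \<in> borel_measurable borel"
  shows "(\<integral>\<^sup>+ x. g x \<partial>\<mu>) * (\<integral>\<^sup>+ x. k x \<partial>L) = (\<integral>\<^sup>+ x. k x \<partial>\<mu>) * (\<integral>\<^sup>+ x. g x \<partial>L)"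
proof -
  obtain B where B[measurable]: "B \<in> sets borel" and B': "0 < emeasure L B" "emeasure L B < \<infinity>"
    using ex_finite_positive by blast
  have "(\<integral>\<^sup>+ x. g x \<partial>L) * emeasure L B = emeasure L B * (\<integral>\<^sup>+ y. g (- y) * ennreal (\<Delta> (- y)) \<partial>L)"
    using left_invariant_swap[OF sigma_finite_L sets_L distr_left, of g "indicator B"] by simp
  then have "(\<integral>\<^sup>+ y. g (- y) * ennreal (\<Delta> (- y)) \<partial>L) = (\<integral>\<^sup>+ x. g x \<partial>L)"
    using B' by (subst (asm) mult.commute, subst (asm) ennreal_mult_cancel_left) auto
  then show ?thesis using left_invariant_swap[OF assms] by simp
qed

end

section \<open>The Campbell measure of a random measure\<close>

locale random_measure =
  fixes P :: "'w measure"
    and m :: "'w \<Rightarrow> 'x::{second_countable_topology, t2_space} measure"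
  assumes loc_compact: "locally compact (UNIV :: 'x set)"
    and sets_m: "\<And>\<omega>. \<omega> \<in> space P \<Longrightarrow> sets (m \<omega>) = sets borel"
    and m_compact: "\<And>\<omega> C. \<omega> \<in> space P \<Longrightarrow> compact C \<Longrightarrow> emeasure (m \<omega>) C < \<infinity>"
    and measurable_m: "\<And>B. B \<in> sets borel \<Longrightarrow> (\<lambda>\<omega>. emeasure (m \<omega>) B) \<in> borel_measurable P"
begin

lemma space_m: "\<omega> \<in> space P \<Longrightarrow> space (m \<omega>) = UNIV"
  using sets_eq_imp_space_eq[OF sets_m] by simp

text \<open>
  Restricting to a compact set makes the masses finite, so that complements can be treated by
  subtraction and the sets with measurable section mass form a Dynkin system.
\<close>

lemma measurable_emeasure_section_Int:
  assumes C: "compact C" and "S \<in> sets (P \<Otimes>\<^sub>M borel)"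
  shows "(\<lambda>\<omega>. emeasure (m \<omega>) (Pair \<omega> -` S \<inter> C)) \<in> borel_measurable P"
proof -
  have C_meas: "C \<in> sets borel" using C by (rule borel_compact)
  show ?thesis
    using Int_stable_pair_measure_generator pair_measure_closed assms(2)
    unfolding sets_pair_measure
  proof (induct rule: sigma_sets_induct_disjoint)
    case (basic A)
    then obtain a b where ab: "A = a \<times> b" "a \<in> sets P" "b \<in> sets borel" by auto
    have "emeasure (m \<omega>) (Pair \<omega> -` A \<inter> C) = indicator a \<omega> * emeasure (m \<omega>) (b \<inter> C)" for \<omega>
      using ab by (auto simp: indicator_def)
    then show ?case using ab C_meas measurable_m[of "b \<inter> C"] by simp
  next
    case empty
    show ?case by simp
  next
    case (compl A)
    have A: "A \<in> sets (P \<Otimes>\<^sub>M borel)" using compl by (simp add: sets_pair_measure)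
    have eq: "emeasure (m \<omega>) (Pair \<omega> -` (space P \<times> space borel - A) \<inter> C)
        = emeasure (m \<omega>) C - emeasure (m \<omega>) (Pair \<omega> -` A \<inter> C)" if \<omega>: "\<omega> \<in> space P" for \<omega>
    proof -
      have sec: "Pair \<omega> -` A \<inter> C \<in> sets (m \<omega>)"
        using sets_Pair1[OF A, of \<omega>] C_meas by (auto simp: sets_m[OF \<omega>])
      have "emeasure (m \<omega>) (Pair \<omega> -` A \<inter> C) \<noteq> \<infinity>"
        using emeasure_mono[of "Pair \<omega> -` A \<inter> C" C "m \<omega>"] C_meas m_compact[OF \<omega> C]
        by (auto simp: sets_m[OF \<omega>] top_unique)
      moreover have "Pair \<omega> -` (space P \<times> space borel - A) \<inter> C = C - (Pair \<omega> -` A \<inter> C)"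
        using \<omega> by auto
      ultimately show ?thesis
        using sec C_meas by (simp add: emeasure_Diff sets_m[OF \<omega>])
    qed
    then show ?case
      using compl(2) measurable_m[OF C_meas] by (intro measurable_cong[OF eq, THEN iffD2]) auto
  next
    case (union F)
    have F: "F i \<in> sets (P \<Otimes>\<^sub>M borel)" for i using union(2) by (auto simp: sets_pair_measure)
    have "emeasure (m \<omega>) (Pair \<omega> -` (\<Union>i. F i) \<inter> C) = (\<Sum>i. emeasure (m \<omega>) (Pair \<omega> -` F i \<inter> C))"
      if \<omega>: "\<omega> \<in> space P" for \<omega>
    proof -
      have "(\<Sum>i. emeasure (m \<omega>) (Pair \<omega> -` F i \<inter> C)) = emeasure (m \<omega>) (\<Union>i. Pair \<omega> -` F i \<inter> C)"
        using union(1) sets_Pair1[OF F, of \<omega>] C_meas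
        by (intro suminf_emeasure) (auto simp: disjoint_family_on_def sets_m[OF \<omega>])
      then show ?thesis by (simp add: vimage_UN)
    qed
    then show ?case using union(3) by (subst measurable_cong) auto
  qed
qed

lemma measurable_emeasure_section:
  assumes S: "S \<in> sets (P \<Otimes>\<^sub>M borel)"
  shows "(\<lambda>\<omega>. emeasure (m \<omega>) (Pair \<omega> -` S)) \<in> borel_measurable P"
proof -
  obtain C :: "nat \<Rightarrow> 'x set" where C: "\<And>n. compact (C n)" "incseq C" "(\<Union>n. C n) = UNIV"
    using compact_exhaustion[OF loc_compact] by metis
  have "emeasure (m \<omega>) (Pair \<omega> -` S) = (SUP n. emeasure (m \<omega>) (Pair \<omega> -` S \<inter> C n))"
    if \<omega>: "\<omega> \<in> space P" for \<omega>
  proof -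
    have "(SUP n. emeasure (m \<omega>) (Pair \<omega> -` S \<inter> C n)) = emeasure (m \<omega>) (\<Union>n. Pair \<omega> -` S \<inter> C n)"
      using sets_Pair1[OF S, of \<omega>] borel_compact[OF C(1)] C(2)
      by (intro SUP_emeasure_incseq) (auto simp: incseq_def sets_m[OF \<omega>])
    also have "(\<Union>n. Pair \<omega> -` S \<inter> C n) = Pair \<omega> -` S" using C(3) by blast
    finally show ?thesis by simp
  qed
  moreover have "(\<lambda>\<omega>. SUP n. emeasure (m \<omega>) (Pair \<omega> -` S \<inter> C n)) \<in> borel_measurable P"
    using measurable_emeasure_section_Int[OF C(1) S] by (intro borel_measurable_SUP) auto
  ultimately show ?thesis by (subst measurable_cong) auto
qed

text \<open>
  The Campbell measure lives on pairs of an outcome and a point. Both symmetries of the situation, the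
  flow and the point-shift, are measure-preserving maps of this one space.
\<close>

definition campbell :: "('w \<times> 'x) measure" where
  "campbell = measure_of (space P \<times> UNIV) (sets (P \<Otimes>\<^sub>M borel))
     (\<lambda>S. \<integral>\<^sup>+ \<omega>. emeasure (m \<omega>) (Pair \<omega> -` S) \<partial>P)"

lemma sets_campbell [simp, measurable_cong]: "sets campbell = sets (P \<Otimes>\<^sub>M borel)"
proof -
  have "sets (P \<Otimes>\<^sub>M (borel :: 'x measure)) \<subseteq> Pow (space P \<times> UNIV)"
    using sets.space_closed[of "P \<Otimes>\<^sub>M (borel :: 'x measure)"] by (simp add: space_pair_measure)
  moreover have "sigma_sets (space P \<times> UNIV) (sets (P \<Otimes>\<^sub>M (borel :: 'x measure))) = sets (P \<Otimes>\<^sub>M borel)"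
    using sets.sigma_sets_eq[of "P \<Otimes>\<^sub>M (borel :: 'x measure)"] by (simp add: space_pair_measure)
  ultimately show ?thesis unfolding campbell_def by (simp add: sets_measure_of)
qed

lemma space_campbell [simp]: "space campbell = space P \<times> UNIV"
  using sets_eq_imp_space_eq[OF sets_campbell] by (simp add: space_pair_measure)

lemma emeasure_campbell:
  assumes S: "S \<in> sets (P \<Otimes>\<^sub>M borel)"
  shows "emeasure campbell S = (\<integral>\<^sup>+ \<omega>. emeasure (m \<omega>) (Pair \<omega> -` S) \<partial>P)"
proof (rule emeasure_measure_of[OF campbell_def])
  show "sets (P \<Otimes>\<^sub>M (borel :: 'x measure)) \<subseteq> Pow (space P \<times> UNIV)"
    using sets.space_closed[of "P \<Otimes>\<^sub>M (borel :: 'x measure)"] by (simp add: space_pair_measure)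
  show "S \<in> sets campbell" using S by simp
  show "positive (sets campbell) (\<lambda>S. \<integral>\<^sup>+ \<omega>. emeasure (m \<omega>) (Pair \<omega> -` S) \<partial>P)"
    by (simp add: positive_def)
  show "countably_additive (sets campbell) (\<lambda>S. \<integral>\<^sup>+ \<omega>. emeasure (m \<omega>) (Pair \<omega> -` S) \<partial>P)"
  proof (rule countably_additiveI)
    fix F :: "nat \<Rightarrow> _" assume F: "range F \<subseteq> sets campbell" "disjoint_family F"
    then have F': "F i \<in> sets (P \<Otimes>\<^sub>M borel)" for i by auto
    have "(\<Sum>i. \<integral>\<^sup>+ \<omega>. emeasure (m \<omega>) (Pair \<omega> -` F i) \<partial>P) = (\<integral>\<^sup>+ \<omega>. (\<Sum>i. emeasure (m \<omega>) (Pair \<omega> -` F i)) \<partial>P)"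
      using measurable_emeasure_section[OF F'] by (intro nn_integral_suminf[symmetric]) auto
    also have "\<dots> = (\<integral>\<^sup>+ \<omega>. emeasure (m \<omega>) (Pair \<omega> -` (\<Union>i. F i)) \<partial>P)"
    proof (intro nn_integral_cong)
      fix \<omega> assume \<omega>: "\<omega> \<in> space P"
      have "(\<Sum>i. emeasure (m \<omega>) (Pair \<omega> -` F i)) = emeasure (m \<omega>) (\<Union>i. Pair \<omega> -` F i)"
        using F(2) sets_Pair1[OF F', of \<omega>]
        by (intro suminf_emeasure) (auto simp: disjoint_family_on_def sets_m[OF \<omega>])
      then show "(\<Sum>i. emeasure (m \<omega>) (Pair \<omega> -` F i)) = emeasure (m \<omega>) (Pair \<omega> -` (\<Union>i. F i))"
        by (simp add: vimage_UN)
    qed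
    finally show "(\<Sum>i. \<integral>\<^sup>+ \<omega>. emeasure (m \<omega>) (Pair \<omega> -` F i) \<partial>P) = (\<integral>\<^sup>+ \<omega>. emeasure (m \<omega>) (Pair \<omega> -` (\<Union>i. F i)) \<partial>P)" .
  qed
qed

lemma
  assumes f: "f \<in> borel_measurable (P \<Otimes>\<^sub>M borel)"
  shows measurable_nn_integral_m: "(\<lambda>\<omega>. \<integral>\<^sup>+ x. f (\<omega>, x) \<partial>m \<omega>) \<in> borel_measurable P" (is "?M f")
    and nn_integral_campbell: "(\<integral>\<^sup>+ z. f z \<partial>campbell) = (\<integral>\<^sup>+ \<omega>. \<integral>\<^sup>+ x. f (\<omega>, x) \<partial>m \<omega> \<partial>P)" (is "?E f")
proof -
  have sec: "(\<lambda>x. g (\<omega>, x)) \<in> borel_measurable (m \<omega>)"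
    if "g \<in> borel_measurable (P \<Otimes>\<^sub>M borel)" "\<omega> \<in> space P" for g :: "'w \<times> 'x \<Rightarrow> ennreal" and \<omega>
    using measurable_compose_Pair1[OF that(2,1)] measurable_cong_sets[OF sets_m[OF that(2)] refl] by auto
  have "?M f \<and> ?E f"
    using f
  proof induct
    case (cong f g)
    then have "f (\<omega>, x) = g (\<omega>, x)" if "\<omega> \<in> space P" for \<omega> x
      using that by (auto simp: space_pair_measure)
    moreover from this have "(\<integral>\<^sup>+ z. f z \<partial>campbell) = (\<integral>\<^sup>+ z. g z \<partial>campbell)"
      by (intro nn_integral_cong) auto
    ultimately show ?case using cong(4)
      by (simp cong: measurable_cong nn_integral_cong)
  next
    case (set S)
    have "(\<integral>\<^sup>+ x. indicator S (\<omega>, x) \<partial>m \<omega>) = emeasure (m \<omega>) (Pair \<omega> -` S)" if "\<omega> \<in> space P" for \<omega>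
    proof -
      have "(\<integral>\<^sup>+ x. indicator S (\<omega>, x) \<partial>m \<omega>) = (\<integral>\<^sup>+ x. indicator (Pair \<omega> -` S) x \<partial>m \<omega>)"
        by (intro nn_integral_cong) (auto simp: indicator_def)
      then show ?thesis using sets_Pair1[OF set, of \<omega>] by (simp add: sets_m[OF that])
    qed
    then show ?case
      using set measurable_emeasure_section[OF set]
      by (simp add: emeasure_campbell cong: measurable_cong nn_integral_cong)
  next
    case (mult f c)
    then show ?case
      by (auto simp: nn_integral_cmult sec cong: measurable_cong nn_integral_cong)
  next
    case (add f g)
    then show ?case
      by (auto simp: nn_integral_add sec cong: measurable_cong nn_integral_cong)
  next
    case (seq F)
    have F: "incseq F" "\<And>i. F i \<in> borel_measurable (P \<Otimes>\<^sub>M borel)" using seq by auto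
    have eq: "(\<integral>\<^sup>+ x. (SUP i. F i) (\<omega>, x) \<partial>m \<omega>) = (SUP i. \<integral>\<^sup>+ x. F i (\<omega>, x) \<partial>m \<omega>)" if "\<omega> \<in> space P" for \<omega>
      using F sec[OF F(2) that] unfolding SUP_apply
      by (intro nn_integral_monotone_convergence_SUP) (auto simp: incseq_def le_fun_def)
    have M: "?M (SUP i. F i)"
      using seq by (intro measurable_cong[OF eq, THEN iffD2] borel_measurable_SUP) auto
    have "(\<integral>\<^sup>+ z. (SUP i. F i) z \<partial>campbell) = (SUP i. \<integral>\<^sup>+ z. F i z \<partial>campbell)"
      using F unfolding SUP_apply by (intro nn_integral_monotone_convergence_SUP) auto
    also have "\<dots> = (SUP i. \<integral>\<^sup>+ \<omega>. \<integral>\<^sup>+ x. F i (\<omega>, x) \<partial>m \<omega> \<partial>P)" using seq by simp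
    also have "\<dots> = (\<integral>\<^sup>+ \<omega>. (SUP i. \<integral>\<^sup>+ x. F i (\<omega>, x) \<partial>m \<omega>) \<partial>P)"
      using seq by (intro nn_integral_monotone_convergence_SUP[symmetric])
        (auto simp: incseq_def le_fun_def intro!: nn_integral_mono)
    also have "\<dots> = (\<integral>\<^sup>+ \<omega>. \<integral>\<^sup>+ x. (SUP i. F i) (\<omega>, x) \<partial>m \<omega> \<partial>P)"
      by (rule nn_integral_cong) (rule eq[symmetric])
    finally show ?case using M by simp
  qed
  then show "?M f" "?E f" by auto
qed

lemma AE_campbell_iff:
  assumes R: "Measurable.pred (P \<Otimes>\<^sub>M borel) R"
  shows "(AE z in campbell. R z) \<longleftrightarrow> (AE \<omega> in P. AE x in m \<omega>. R (\<omega>, x))"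
proof -
  let ?S = "{z \<in> space (P \<Otimes>\<^sub>M borel). \<not> R z}"
  have S: "?S \<in> sets (P \<Otimes>\<^sub>M borel)" using R by measurable
  have "(AE z in campbell. R z) \<longleftrightarrow> emeasure campbell ?S = 0"
    using S by (subst AE_iff_measurable[of ?S]) (auto simp: space_pair_measure)
  also have "\<dots> \<longleftrightarrow> (AE \<omega> in P. emeasure (m \<omega>) (Pair \<omega> -` ?S) = 0)"
    using measurable_emeasure_section[OF S] by (simp add: emeasure_campbell[OF S] nn_integral_0_iff_AE)
  also have "\<dots> \<longleftrightarrow> (AE \<omega> in P. AE x in m \<omega>. R (\<omega>, x))"
  proof (intro AE_cong)
    fix \<omega> assume \<omega>: "\<omega> \<in> space P"
    have "Pair \<omega> -` ?S \<in> sets (m \<omega>)" using sets_Pair1[OF S, of \<omega>] by (simp add: sets_m[OF \<omega>])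
    then show "emeasure (m \<omega>) (Pair \<omega> -` ?S) = 0 \<longleftrightarrow> (AE x in m \<omega>. R (\<omega>, x))"
      using \<omega> by (subst AE_iff_measurable[of "Pair \<omega> -` ?S"]) (auto simp: space_pair_measure space_m)
  qed
  finally show ?thesis .
qed

end

section \<open>The Palm measure\<close>

locale stationary_point_process = haar L \<Delta>
  for L :: "'x::{topological_group_add, second_countable_topology, t2_space} measure"
    and \<Delta> :: "'x \<Rightarrow> real" +
  fixes P :: "'w measure"
    and \<theta> :: "'x \<Rightarrow> 'w \<Rightarrow> 'w"
    and m :: "'w \<Rightarrow> 'x measure"
    and \<gamma> :: ennreal
    and w :: "'x \<Rightarrow> real"
  assumes stationary: "stationary_framework P \<theta>"
    and point_process: "simple_point_process P m"
    and adapted: "flow_adapted_process P \<theta> m"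
    and intensity: "has_intensity P L m \<gamma>" "0 < \<gamma>" "\<gamma> < \<infinity>"
    and w_measurable [measurable]: "w \<in> borel_measurable borel"
    and w_nonneg: "\<And>x. 0 \<le> w x"
    and w_integral: "(\<integral>\<^sup>+ x. ennreal (w x) \<partial>L) = 1"
begin

sublocale random_measure P m
  using point_process
  by unfold_locales
    (auto simp: locally_compact simple_point_process_def counting_measure_def locally_finite_measure_def)

lemma measurable_flow [measurable (raw)]:
  assumes "f \<in> borel_measurable M" "g \<in> M \<rightarrow>\<^sub>M P"
  shows "(\<lambda>z. \<theta> (f z) (g z)) \<in> M \<rightarrow>\<^sub>M P"
proof -
  have "(\<lambda>(x, \<omega>). \<theta> x \<omega>) \<in> borel \<Otimes>\<^sub>M P \<rightarrow>\<^sub>M P"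
    using stationary by (simp add: stationary_framework_def)
  from measurable_compose[OF measurable_Pair[OF assms] this] show ?thesis by simp
qed

lemma flow_space [simp]: "\<omega> \<in> space P \<Longrightarrow> \<theta> x \<omega> \<in> space P"
  using measurable_space[OF measurable_flow[of "\<lambda>_. x" P "\<lambda>\<omega>. \<omega>"]] by simp

lemma flow_add: "\<omega> \<in> space P \<Longrightarrow> \<theta> x (\<theta> y \<omega>) = \<theta> (x + y) \<omega>"
  using stationary by (simp add: stationary_framework_def)

lemma distr_flow: "distr P P (\<theta> x) = P"
  using stationary by (simp add: stationary_framework_def)

lemma m_flow: "\<omega> \<in> space P \<Longrightarrow> m (\<theta> y \<omega>) = distr (m \<omega>) borel ((+) y)"
proof (rule measure_eqI)
  assume \<omega>: "\<omega> \<in> space P"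
  note [measurable_cong] = sets_m[OF \<omega>]
  show "sets (m (\<theta> y \<omega>)) = sets (distr (m \<omega>) borel ((+) y))" using \<omega> by (simp add: sets_m)
  fix B assume "B \<in> sets (m (\<theta> y \<omega>))"
  then have B[measurable]: "B \<in> sets borel" using \<omega> by (simp add: sets_m)
  have "(+) y -` B = (\<lambda>b. - y + b) ` B"
    by (auto simp: image_iff add.assoc[symmetric] intro!: bexI[of _ "y + _"])
  then show "emeasure (m (\<theta> y \<omega>)) B = emeasure (distr (m \<omega>) borel ((+) y)) B"
    using adapted \<omega> by (simp add: emeasure_distr flow_adapted_process_def space_m)
qed

lemma nn_integral_m_flow:
  assumes "\<omega> \<in> space P" and [measurable]: "f \<in> borel_measurable borel"
  shows "(\<integral>\<^sup>+ x. f x \<partial>m (\<theta> y \<omega>)) = (\<integral>\<^sup>+ x. f (y + x) \<partial>m \<omega>)"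
proof -
  note [measurable_cong] = sets_m[OF assms(1)]
  show ?thesis unfolding m_flow[OF assms(1)] by (rule nn_integral_distr) measurable
qed

lemma m_properties:
  assumes "\<omega> \<in> space P"
  shows "counting_measure (m \<omega>)" "locally_finite_measure (m \<omega>)"
    "emeasure (m \<omega>) {x} \<noteq> 0 \<Longrightarrow> emeasure (m \<omega>) {x} = 1"
  using assms point_process by (auto simp: simple_point_process_def)

lemma AE_m_iff: "\<omega> \<in> space P \<Longrightarrow> (AE x in m \<omega>. R x) \<longleftrightarrow> (\<forall>x\<in>supp (m \<omega>). R x)"
  by (rule counting_measure_AE_iff[OF locally_compact m_properties(1,2)])

text \<open>
  Stationarity of \<open>P\<close>, joined with the flow-adaptedness of \<open>m\<close>.
\<close>

lemma campbell_flow: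
  assumes f[measurable]: "f \<in> borel_measurable (P \<Otimes>\<^sub>M borel)"
  shows "(\<integral>\<^sup>+ z. f (\<theta> y (fst z), y + snd z) \<partial>campbell) = (\<integral>\<^sup>+ z. f z \<partial>campbell)"
proof -
  have "(\<integral>\<^sup>+ z. f (\<theta> y (fst z), y + snd z) \<partial>campbell) = (\<integral>\<^sup>+ \<omega>. \<integral>\<^sup>+ x. f (\<theta> y \<omega>, y + x) \<partial>m \<omega> \<partial>P)"
    by (subst nn_integral_campbell) auto
  also have "\<dots> = (\<integral>\<^sup>+ \<omega>. \<integral>\<^sup>+ x. f (\<theta> y \<omega>, x) \<partial>m (\<theta> y \<omega>) \<partial>P)"
    by (intro nn_integral_cong nn_integral_m_flow[symmetric] measurable_compose_Pair1[OF _ f]) auto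
  also have "\<dots> = (\<integral>\<^sup>+ \<omega>. \<integral>\<^sup>+ x. f (\<omega>, x) \<partial>m \<omega> \<partial>distr P P (\<theta> y))"
    by (subst nn_integral_distr) (auto intro!: measurable_nn_integral_m f)
  also have "\<dots> = (\<integral>\<^sup>+ z. f z \<partial>campbell)"
    by (simp add: distr_flow nn_integral_campbell f)
  finally show ?thesis .
qed

lemma campbell_compact:
  assumes C: "compact C"
  shows "emeasure campbell (space P \<times> C) < \<infinity>"
proof -
  have Cm[measurable]: "C \<in> sets borel" using C by (rule borel_compact)
  obtain B where B: "compact B" "0 < emeasure L B"
    using ex_compact_positive by blast
  then have [measurable]: "B \<in> sets borel" by (simp add: borel_compact)
  \<comment> \<open>The intensity describes the expected mass of sets of positive measure only, and \<open>C\<close> may be null.\<close>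
  have fin: "emeasure L (C \<union> B) < \<infinity>"
    using C B(1) by (intro emeasure_compact_finite compact_Un)
  have pos: "0 < emeasure L (C \<union> B)"
    using emeasure_mono[of B "C \<union> B" L] B(2) by (auto intro: less_le_trans)
  have "\<gamma> = (\<integral>\<^sup>+ \<omega>. emeasure (m \<omega>) (C \<union> B) \<partial>P) / emeasure L (C \<union> B)"
    using intensity(1) fin pos unfolding has_intensity_def by auto
  then have "(\<integral>\<^sup>+ \<omega>. emeasure (m \<omega>) (C \<union> B) \<partial>P) < \<infinity>"
    using intensity(3) fin pos by (auto simp: less_top[symmetric] divide_ennreal_def ennreal_top_mult)
  moreover have "emeasure campbell (space P \<times> C) \<le> (\<integral>\<^sup>+ \<omega>. emeasure (m \<omega>) (C \<union> B) \<partial>P)"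
    by (subst emeasure_campbell) (auto intro!: nn_integral_mono emeasure_mono simp: sets_m)
  ultimately show ?thesis by (rule le_less_trans[rotated])
qed

text \<open>
  This is the Palm probability multiplied by the intensity. Without the normalisation it is the image of a
  density of the Campbell measure, and the factor, being positive and finite, does not affect invariance.
\<close>

definition palm_measure :: "'w measure" where
  "palm_measure = distr (density campbell (\<lambda>z. ennreal (w (snd z)))) P (\<lambda>z. \<theta> (- snd z) (fst z))"

lemma sets_palm_measure [simp, measurable_cong]: "sets palm_measure = sets P"
  by (simp add: palm_measure_def)

lemma space_palm_measure [simp]: "space palm_measure = space P"
  by (simp add: palm_measure_def)

lemma nn_integral_palm_measure:
  assumes [measurable]: "f \<in> borel_measurable P"
  shows "(\<integral>\<^sup>+ \<omega>. f \<omega> \<partial>palm_measure) = (\<integral>\<^sup>+ z. ennreal (w (snd z)) * f (\<theta> (- snd z) (fst z)) \<partial>campbell)"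
  unfolding palm_measure_def
  by (subst nn_integral_distr) (auto simp: nn_integral_density)

lemma palm_prob_eq:
  assumes [measurable]: "A \<in> sets P"
  shows "palm_prob P \<theta> m \<gamma> w A = 1 / \<gamma> * emeasure palm_measure A"
proof -
  have "emeasure palm_measure A = (\<integral>\<^sup>+ \<omega>. indicator A \<omega> \<partial>palm_measure)" by simp
  also have "\<dots> = (\<integral>\<^sup>+ \<omega>. \<integral>\<^sup>+ x. indicator A (\<theta> (- x) \<omega>) * ennreal (w x) \<partial>m \<omega> \<partial>P)"
    by (subst nn_integral_palm_measure) (auto simp: nn_integral_campbell mult.commute)
  finally show ?thesis by (simp add: palm_prob_def)
qed

lemma palm_prob_eq_iff:
  assumes "A \<in> sets P" "B \<in> sets P"
  shows "palm_prob P \<theta> m \<gamma> w A = palm_prob P \<theta> m \<gamma> w B \<longleftrightarrow> emeasure palm_measure A = emeasure palm_measure B"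
  using intensity
  by (auto simp: palm_prob_eq[OF assms(1)] palm_prob_eq[OF assms(2)] ennreal_mult_cancel_left
      divide_ennreal_def ennreal_inverse_eq_0_iff)

text \<open>
  For fixed \<open>A\<close> the left-hand side is a measure in \<open>B\<close>. It is left-invariant, since applying \<open>\<theta> y\<close> to the
  outcome and translating the point by \<open>y\<close> does not change the outcome seen from the point. Hence it is a multiple of \<open>L\<close>, and
  integrating \<open>w\<close> gives the factor.
\<close>

lemma campbell_rectangle:
  assumes [measurable]: "A \<in> sets P" "B \<in> sets borel"
  shows "(\<integral>\<^sup>+ z. indicator A (\<theta> (- snd z) (fst z)) * indicator B (snd z) \<partial>campbell)
    = emeasure palm_measure A * emeasure L B"
proof -
  \<comment> \<open>The left-hand side of the claim as a measure in \<open>B\<close>.\<close>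
  define \<mu> where "\<mu> = distr (density campbell (\<lambda>z. indicator A (\<theta> (- snd z) (fst z)))) borel snd"
  have sets_\<mu>[simp, measurable_cong]: "sets \<mu> = sets borel" by (simp add: \<mu>_def)
  have int: "(\<integral>\<^sup>+ x. g x \<partial>\<mu>) = (\<integral>\<^sup>+ z. indicator A (\<theta> (- snd z) (fst z)) * g (snd z) \<partial>campbell)"
    if [measurable]: "g \<in> borel_measurable borel" for g :: "'x \<Rightarrow> ennreal"
    unfolding \<mu>_def by (subst nn_integral_distr) (auto simp: nn_integral_density)
  have em: "emeasure \<mu> C = (\<integral>\<^sup>+ z. indicator A (\<theta> (- snd z) (fst z)) * indicator C (snd z) \<partial>campbell)"
    if "C \<in> sets borel" for C
    using int[of "indicator C"] that by simp
  have "sigma_finite_measure \<mu>"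
  proof (rule sigma_finite_if_finite_on_compacts[OF locally_compact sets_\<mu>])
    fix C :: "'x set" assume C: "compact C"
    then have [measurable]: "C \<in> sets borel" by (rule borel_compact)
    have "emeasure \<mu> C \<le> (\<integral>\<^sup>+ z. indicator (space P \<times> C) z \<partial>campbell)"
      unfolding em[OF \<open>C \<in> sets borel\<close>] by (intro nn_integral_mono) (auto split: split_indicator)
    also have "\<dots> < \<infinity>" using campbell_compact[OF C] by simp
    finally show "emeasure \<mu> C < \<infinity>" .
  qed
  moreover have "distr \<mu> borel ((+) y) = \<mu>" for y
  proof (rule measure_eqI)
    fix C assume "C \<in> sets (distr \<mu> borel ((+) y))"
    then have C[measurable]: "C \<in> sets borel" by simp
    have "emeasure (distr \<mu> borel ((+) y)) C = (\<integral>\<^sup>+ x. indicator C (y + x) \<partial>\<mu>)"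
      using nn_integral_distr[of "(+) y" \<mu> borel "indicator C"] by simp
    also have "\<dots> = (\<integral>\<^sup>+ z. indicator A (\<theta> (- snd z) (fst z)) * indicator C (y + snd z) \<partial>campbell)"
      by (rule int) measurable
    \<comment> \<open>The outcome seen from the point is written through the moved outcome and the moved point.\<close>
    also have "\<dots> = (\<integral>\<^sup>+ z. indicator A (\<theta> (- (y + snd z)) (\<theta> y (fst z))) * indicator C (y + snd z) \<partial>campbell)"
      by (intro nn_integral_cong) (auto simp: flow_add minus_add add.assoc)
    also have "\<dots> = emeasure \<mu> C"
      using campbell_flow[of "\<lambda>z. indicator A (\<theta> (- snd z) (fst z)) * indicator C (snd z)" y]
      by (simp add: em)
    finally show "emeasure (distr \<mu> borel ((+) y)) C = emeasure \<mu> C" .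
  qed simp
  ultimately have "(\<integral>\<^sup>+ x. indicator B x \<partial>\<mu>) * (\<integral>\<^sup>+ x. ennreal (w x) \<partial>L) = (\<integral>\<^sup>+ x. ennreal (w x) \<partial>\<mu>) * (\<integral>\<^sup>+ x. indicator B x \<partial>L)"
    by (intro left_invariant_unique) simp_all
  moreover have "(\<integral>\<^sup>+ x. ennreal (w x) \<partial>\<mu>) = emeasure palm_measure A"
    using nn_integral_palm_measure[of "indicator A"] by (simp add: int mult.commute)
  ultimately show ?thesis using w_integral by (simp add: em)
qed

lemma finite_palm_measure: "finite_measure palm_measure"
proof (rule finite_measureI)
  obtain C where C: "compact C" "0 < emeasure L C"
    using ex_compact_positive by blast
  then have [measurable]: "C \<in> sets borel" by (simp add: borel_compact)
  have "emeasure palm_measure (space P) * emeasure L C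
      = (\<integral>\<^sup>+ z. indicator (space P) (\<theta> (- snd z) (fst z)) * indicator C (snd z) \<partial>campbell)"
    by (rule campbell_rectangle[symmetric]) auto
  also have "\<dots> = (\<integral>\<^sup>+ z. indicator (space P \<times> C) z \<partial>campbell)"
    by (intro nn_integral_cong) (auto split: split_indicator)
  also have "\<dots> < \<infinity>" using campbell_compact[OF C(1)] by simp
  finally show "emeasure palm_measure (space palm_measure) \<noteq> \<infinity>"
    using C(2) by (auto simp: ennreal_top_mult split: if_splits)
qed

text \<open>
  The outcome seen from a point carries no information on the location of the point: in these coordinates the
  Campbell measure is a product.
\<close>

theorem refined_campbell:
  "palm_measure \<Otimes>\<^sub>M L = distr campbell (P \<Otimes>\<^sub>M borel) (\<lambda>z. (\<theta> (- snd z) (fst z), snd z))"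
proof (rule pair_measure_eqI)
  show "sigma_finite_measure palm_measure"
    using finite_palm_measure by (simp add: finite_measure_def)
  show "sigma_finite_measure L" by (rule sigma_finite_L)
  show "sets (palm_measure \<Otimes>\<^sub>M L) = sets (distr campbell (P \<Otimes>\<^sub>M borel) (\<lambda>z. (\<theta> (- snd z) (fst z), snd z)))"
    by (simp cong: sets_pair_measure_cong)
  fix A B assume "A \<in> sets palm_measure" "B \<in> sets L"
  then have AB[measurable]: "A \<in> sets P" "B \<in> sets borel" by auto
  have "emeasure (distr campbell (P \<Otimes>\<^sub>M borel) (\<lambda>z. (\<theta> (- snd z) (fst z), snd z))) (A \<times> B)
    = (\<integral>\<^sup>+ z. indicator (A \<times> B) z \<partial>distr campbell (P \<Otimes>\<^sub>M borel) (\<lambda>z. (\<theta> (- snd z) (fst z), snd z)))"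
    by simp
  also have "\<dots> = (\<integral>\<^sup>+ z. indicator (A \<times> B) (\<theta> (- snd z) (fst z), snd z) \<partial>campbell)"
    by (rule nn_integral_distr) measurable
  also have "\<dots> = emeasure palm_measure A * emeasure L B"
    by (simp add: campbell_rectangle[symmetric] indicator_times AB)
  finally show "emeasure palm_measure A * emeasure L B
    = emeasure (distr campbell (P \<Otimes>\<^sub>M borel) (\<lambda>z. (\<theta> (- snd z) (fst z), snd z))) (A \<times> B)" by simp
qed

corollary nn_integral_refined_campbell:
  assumes [measurable]: "f \<in> borel_measurable (P \<Otimes>\<^sub>M borel)"
  shows "(\<integral>\<^sup>+ z. f (\<theta> (- snd z) (fst z), snd z) \<partial>campbell) = (\<integral>\<^sup>+ \<omega>. \<integral>\<^sup>+ x. f (\<omega>, x) \<partial>L \<partial>palm_measure)"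
proof -
  interpret L: sigma_finite_measure L by (rule sigma_finite_L)
  have "f \<in> borel_measurable (palm_measure \<Otimes>\<^sub>M L)"
    by (simp cong: measurable_cong_sets sets_pair_measure_cong)
  then have "(\<integral>\<^sup>+ \<omega>. \<integral>\<^sup>+ x. f (\<omega>, x) \<partial>L \<partial>palm_measure) = (\<integral>\<^sup>+ z. f z \<partial>(palm_measure \<Otimes>\<^sub>M L))"
    by (rule L.nn_integral_fst)
  also have "\<dots> = (\<integral>\<^sup>+ z. f (\<theta> (- snd z) (fst z), snd z) \<partial>campbell)"
    unfolding refined_campbell by (rule nn_integral_distr) measurable
  finally show ?thesis by simp
qed

text \<open>
  A property holds under the Palm measure if it holds seen from every point. The weight \<open>w\<close> may vanish on a
  large set, and the definition of \<open>palm_measure\<close> alone tells nothing about points there; the refined Campbell theorem replaces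
  \<open>w\<close> by the constant \<open>1\<close>.
\<close>

lemma AE_palm_iff:
  assumes R[measurable]: "Measurable.pred P R"
  shows "(AE \<omega> in palm_measure. R \<omega>) \<longleftrightarrow> (AE \<omega> in P. \<forall>x\<in>supp (m \<omega>). R (\<theta> (- x) \<omega>))"
proof -
  let ?N = "\<lambda>\<omega>. indicator {\<omega>\<in>space P. \<not> R \<omega>} \<omega> :: ennreal"
  \<comment> \<open>The factor is not \<open>0\<close>; it is the integral of \<open>1\<close> over the locations, which the refined Campbell theorem needs.\<close>
  have "(AE \<omega> in palm_measure. R \<omega>) \<longleftrightarrow> (AE \<omega> in palm_measure. ?N \<omega> * emeasure L UNIV = 0)"
    using haar by (intro AE_cong) (auto simp: indicator_def left_haar_measure_def)
  also have "\<dots> \<longleftrightarrow> (\<integral>\<^sup>+ \<omega>. ?N \<omega> * emeasure L UNIV \<partial>palm_measure) = 0"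
    by (subst nn_integral_0_iff_AE) auto
  also have "\<dots> \<longleftrightarrow> (\<integral>\<^sup>+ z. ?N (\<theta> (- snd z) (fst z)) \<partial>campbell) = 0"
    using nn_integral_refined_campbell[of "\<lambda>z. ?N (fst z)"] by simp
  also have "\<dots> \<longleftrightarrow> (AE z in campbell. R (\<theta> (- snd z) (fst z)))"
    by (subst nn_integral_0_iff_AE) (auto intro!: AE_cong simp: indicator_def)
  also have "\<dots> \<longleftrightarrow> (AE \<omega> in P. AE x in m \<omega>. R (\<theta> (- x) \<omega>))"
    by (subst AE_campbell_iff) auto
  also have "\<dots> \<longleftrightarrow> (AE \<omega> in P. \<forall>x\<in>supp (m \<omega>). R (\<theta> (- x) \<omega>))"
    by (intro AE_cong) (simp add: AE_m_iff)
  finally show ?thesis .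
qed

end

section \<open>Bijective point-shifts and the Palm measure\<close>

locale bijective_point_shift = stationary_point_process L \<Delta> P \<theta> m \<gamma> w
  for L :: "'x::{topological_group_add, second_countable_topology, t2_space} measure"
    and \<Delta> :: "'x \<Rightarrow> real"
    and P :: "'w measure"
    and \<theta> :: "'x \<Rightarrow> 'w \<Rightarrow> 'w"
    and m :: "'w \<Rightarrow> 'x measure"
    and \<gamma> :: ennreal
    and w :: "'x \<Rightarrow> real" +
  fixes H :: "'w \<Rightarrow> 'x \<Rightarrow> 'x"
  assumes shift: "point_shift P \<theta> m H"
    and bijective: "bijective_shift P m H"
begin

lemma measurable_shift [measurable (raw)]:
  assumes "f \<in> M \<rightarrow>\<^sub>M P" "g \<in> borel_measurable M"
  shows "(\<lambda>z. H (f z) (g z)) \<in> borel_measurable M"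
proof -
  have "(\<lambda>(\<omega>, x). H \<omega> x) \<in> P \<Otimes>\<^sub>M borel \<rightarrow>\<^sub>M borel"
    using shift by (simp add: point_shift_def)
  from measurable_compose[OF measurable_Pair[OF assms] this] show ?thesis by simp
qed

lemma shift_flow: 
  assumes "\<omega> \<in> space P"
  shows "H (\<theta> y \<omega>) x = y + H \<omega> (- y + x)"
proof -
  have "H (\<theta> y \<omega>) (y + (- y + x)) = y + H \<omega> (- y + x)"
    using shift assms unfolding point_shift_def by blast
  then show ?thesis by (simp add: add.assoc[symmetric])
qed

text \<open>
  The outcome recentred at the image of the origin under the point-shift.
\<close>

definition flow_back :: "'w \<Rightarrow> 'w" where
  "flow_back \<omega> = \<theta> (- point_map H \<omega>) \<omega>"

lemma measurable_flow_back [measurable]: "flow_back \<in> P \<rightarrow>\<^sub>M P"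
  unfolding flow_back_def point_map_def by measurable

lemma measurable_point_map [measurable]: "point_map H \<in> borel_measurable P"
  unfolding point_map_def by measurable

lemma point_map_flow: "\<omega> \<in> space P \<Longrightarrow> point_map H (\<theta> (- x) \<omega>) = - x + H \<omega> x"
  by (simp add: point_map_def shift_flow)

lemma flow_back_flow: "\<omega> \<in> space P \<Longrightarrow> flow_back (\<theta> (- x) \<omega>) = \<theta> (- H \<omega> x) \<omega>"
  by (simp add: flow_back_def point_map_flow flow_add minus_add add.assoc)

text \<open>
  For almost every outcome the point-shift permutes the points, hence leaves every sum over the points
  unchanged.
\<close>

lemma campbell_shift:
  assumes f[measurable]: "f \<in> borel_measurable (P \<Otimes>\<^sub>M borel)"
  shows "(\<integral>\<^sup>+ z. f (fst z, H (fst z) (snd z)) \<partial>campbell) = (\<integral>\<^sup>+ z. f z \<partial>campbell)"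
proof -
  have "(\<integral>\<^sup>+ z. f (fst z, H (fst z) (snd z)) \<partial>campbell) = (\<integral>\<^sup>+ \<omega>. \<integral>\<^sup>+ x. f (\<omega>, H \<omega> x) \<partial>m \<omega> \<partial>P)"
    by (subst nn_integral_campbell) auto
  also have "\<dots> = (\<integral>\<^sup>+ \<omega>. \<integral>\<^sup>+ x. f (\<omega>, x) \<partial>m \<omega> \<partial>P)"
  proof (rule nn_integral_cong_AE)
    have "AE \<omega> in P. bij_betw (H \<omega>) (supp (m \<omega>)) (supp (m \<omega>))"
      using bijective by (simp add: bijective_shift_def)
    then show "AE \<omega> in P. (\<integral>\<^sup>+ x. f (\<omega>, H \<omega> x) \<partial>m \<omega>) = (\<integral>\<^sup>+ x. f (\<omega>, x) \<partial>m \<omega>)"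
      using AE_space
    proof eventually_elim
      fix \<omega> assume bij: "bij_betw (H \<omega>) (supp (m \<omega>)) (supp (m \<omega>))" and \<omega>[measurable]: "\<omega> \<in> space P"
      note count = nn_integral_simple_counting_measure[OF locally_compact m_properties[OF \<omega>]]
      have "(\<integral>\<^sup>+ x. f (\<omega>, H \<omega> x) \<partial>m \<omega>) = (\<integral>\<^sup>+ x. f (\<omega>, H \<omega> x) \<partial>count_space (supp (m \<omega>)))"
        by (rule count) measurable
      also have "\<dots> = (\<integral>\<^sup>+ x. f (\<omega>, x) \<partial>count_space (supp (m \<omega>)))"
        by (rule nn_integral_bij_count_space[OF bij])
      also have "\<dots> = (\<integral>\<^sup>+ x. f (\<omega>, x) \<partial>m \<omega>)"
        by (rule count[symmetric]) measurable
      finally show "(\<integral>\<^sup>+ x. f (\<omega>, H \<omega> x) \<partial>m \<omega>) = (\<integral>\<^sup>+ x. f (\<omega>, x) \<partial>m \<omega>)" .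
    qed
  qed
  also have "\<dots> = (\<integral>\<^sup>+ z. f z \<partial>campbell)"
    by (simp add: nn_integral_campbell f)
  finally show ?thesis .
qed

text \<open>
  Invariance of the Campbell measure under the point-shift, in the coordinates of the refined Campbell
  theorem: the outcome seen from the point changes by \<open>flow_back\<close>, while the location is translated by \<open>point_map H\<close>
  from the right. The location is integrated out under \<open>L\<close>, and the right translation costs the modulus.
\<close>

lemma palm_change_of_variables:
  assumes [measurable]: "f \<in> borel_measurable P"
  shows "(\<integral>\<^sup>+ \<omega>. f \<omega> \<partial>palm_measure)
    = (\<integral>\<^sup>+ \<omega>. f (flow_back \<omega>) * ennreal (\<Delta> (- point_map H \<omega>)) \<partial>palm_measure)"
proof -
  have "(\<integral>\<^sup>+ \<omega>. f \<omega> \<partial>palm_measure) = (\<integral>\<^sup>+ z. ennreal (w (snd z)) * f (\<theta> (- snd z) (fst z)) \<partial>campbell)"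
    by (rule nn_integral_palm_measure) measurable
  also have "\<dots> = (\<integral>\<^sup>+ z. ennreal (w (H (fst z) (snd z))) * f (\<theta> (- H (fst z) (snd z)) (fst z)) \<partial>campbell)"
    using campbell_shift[of "\<lambda>z. ennreal (w (snd z)) * f (\<theta> (- snd z) (fst z))"] by simp
  also have "\<dots> = (\<integral>\<^sup>+ z. ennreal (w (snd z + point_map H (\<theta> (- snd z) (fst z)))) * f (flow_back (\<theta> (- snd z) (fst z))) \<partial>campbell)"
    by (intro nn_integral_cong) (auto simp: point_map_flow flow_back_flow add.assoc[symmetric])
  also have "\<dots> = (\<integral>\<^sup>+ \<omega>. \<integral>\<^sup>+ x. ennreal (w (x + point_map H \<omega>)) * f (flow_back \<omega>) \<partial>L \<partial>palm_measure)"
    using nn_integral_refined_campbell[of "\<lambda>z. ennreal (w (snd z + point_map H (fst z))) * f (flow_back (fst z))"]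
    by simp
  also have "\<dots> = (\<integral>\<^sup>+ \<omega>. f (flow_back \<omega>) * ennreal (\<Delta> (- point_map H \<omega>)) \<partial>palm_measure)"
  proof (rule nn_integral_cong)
    fix \<omega>
    show "(\<integral>\<^sup>+ x. ennreal (w (x + point_map H \<omega>)) * f (flow_back \<omega>) \<partial>L) = f (flow_back \<omega>) * ennreal (\<Delta> (- point_map H \<omega>))"
      using nn_integral_right[of "\<lambda>x. ennreal (w x)" "point_map H \<omega>"]
      by (subst nn_integral_multc) (simp_all add: w_integral mult.commute)
  qed
  finally show ?thesis .
qed

lemma isomodular_iff_AE_palm:
  "isomodular P \<Delta> m H \<longleftrightarrow> (AE \<omega> in palm_measure. \<Delta> (- point_map H \<omega>) = 1)"
proof -
  have "(AE \<omega> in palm_measure. \<Delta> (- point_map H \<omega>) = 1)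
    \<longleftrightarrow> (AE \<omega> in P. \<forall>x\<in>supp (m \<omega>). \<Delta> (- point_map H (\<theta> (- x) \<omega>)) = 1)"
    by (rule AE_palm_iff) measurable
  also have "\<dots> \<longleftrightarrow> (AE \<omega> in P. \<forall>x\<in>supp (m \<omega>). \<Delta> x = \<Delta> (H \<omega> x))"
    by (intro AE_cong ball_cong refl)
      (auto simp: point_map_flow minus_add modular_mult modular_minus)
  finally show ?thesis by (simp add: isomodular_def)
qed

text \<open>
  The sum of \<open>\<Delta> x\<close> over all points \<open>x\<close> that are mapped to the origin. When the point-shift is bijective and
  the origin is a point, this is the modulus of the preimage of the origin. Written as an integral it is measurable
  without any discussion of the inverse shift.
\<close>

definition incoming_modulus :: "'w \<Rightarrow> ennreal" where
  "incoming_modulus \<omega> = (\<integral>\<^sup>+ x. indicator {0} (H \<omega> x) * ennreal (\<Delta> x) \<partial>m \<omega>)"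

lemma measurable_incoming_modulus [measurable]: "incoming_modulus \<in> borel_measurable P"
  unfolding incoming_modulus_def
  using measurable_nn_integral_m[of "\<lambda>z. indicator {0} (H (fst z) (snd z)) * ennreal (\<Delta> (snd z))"]
  by simp

text \<open>
  In the outcome recentred at the image of a point \<open>x\<close>, the only point mapped to the origin is
  \<open>- H \<omega> x + x\<close>. So the density in \<open>palm_change_of_variables\<close> factors through \<open>flow_back\<close>.
\<close>

lemma incoming_modulus_flow_back:
  "AE \<omega> in palm_measure. incoming_modulus (flow_back \<omega>) = ennreal (\<Delta> (- point_map H \<omega>))"
proof (rule AE_palm_iff[THEN iffD2])
  have "AE \<omega> in P. bij_betw (H \<omega>) (supp (m \<omega>)) (supp (m \<omega>))"
    using bijective by (simp add: bijective_shift_def)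
  then show "AE \<omega> in P. \<forall>x\<in>supp (m \<omega>).
    incoming_modulus (flow_back (\<theta> (- x) \<omega>)) = ennreal (\<Delta> (- point_map H (\<theta> (- x) \<omega>)))"
    using AE_space
  proof (eventually_elim, intro ballI)
    fix \<omega> x assume bij: "bij_betw (H \<omega>) (supp (m \<omega>)) (supp (m \<omega>))" and \<omega>: "\<omega> \<in> space P"
      and x: "x \<in> supp (m \<omega>)"
    note [measurable_cong] = sets_m[OF \<omega>]
    have [measurable]: "\<theta> (- H \<omega> x) \<omega> \<in> space P" using \<omega> by simp
    have \<omega>'[measurable]: "\<omega> \<in> space P" by fact
    have "incoming_modulus (flow_back (\<theta> (- x) \<omega>))
      = (\<integral>\<^sup>+ z. indicator {0} (H (\<theta> (- H \<omega> x) \<omega>) (- H \<omega> x + z)) * ennreal (\<Delta> (- H \<omega> x + z)) \<partial>m \<omega>)"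
      unfolding incoming_modulus_def flow_back_flow[OF \<omega>] by (rule nn_integral_m_flow[OF \<omega>]) measurable
    also have "\<dots> = (\<integral>\<^sup>+ z. ennreal (\<Delta> (- H \<omega> x + x)) * indicator {x} z \<partial>m \<omega>)"
    proof (rule nn_integral_cong_AE, unfold AE_m_iff[OF \<omega>], rule ballI)
      fix z assume z: "z \<in> supp (m \<omega>)"
      have "H (\<theta> (- H \<omega> x) \<omega>) (- H \<omega> x + z) = - H \<omega> x + H \<omega> z"
        using \<omega> by (simp add: shift_flow add.assoc[symmetric])
      moreover have "- H \<omega> x + H \<omega> z = 0 \<longleftrightarrow> z = x"
        using bij x z by (auto simp: bij_betw_def inj_on_def dest: minus_unique)
      ultimately show "indicator {0} (H (\<theta> (- H \<omega> x) \<omega>) (- H \<omega> x + z)) * ennreal (\<Delta> (- H \<omega> x + z))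
        = ennreal (\<Delta> (- H \<omega> x + x)) * indicator {x} z"
        by (auto simp: indicator_def)
    qed
    also have "\<dots> = ennreal (\<Delta> (- H \<omega> x + x)) * emeasure (m \<omega>) {x}"
      by (rule nn_integral_cmult_indicator) (simp add: sets_m[OF \<omega>])
    also have "\<dots> = ennreal (\<Delta> (- H \<omega> x + x))"
      using x m_properties(3)[OF \<omega>, of x] by (simp add: supp_def)
    finally show "incoming_modulus (flow_back (\<theta> (- x) \<omega>)) = ennreal (\<Delta> (- point_map H (\<theta> (- x) \<omega>)))"
      by (simp add: point_map_flow[OF \<omega>] minus_add)
  qed
qed measurable

lemma preserves_palm_iff: "preserves_palm P \<theta> m \<gamma> w H \<longleftrightarrow> distr palm_measure P flow_back = palm_measure"
proof -
  have em: "emeasure (distr palm_measure P flow_back) A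
      = emeasure palm_measure {\<omega>\<in>space P. \<theta> (- point_map H \<omega>) \<omega> \<in> A}" if "A \<in> sets P" for A
    using that by (subst emeasure_distr) (auto simp: flow_back_def vimage_def Int_def conj_commute)
  have "{\<omega>\<in>space P. \<theta> (- point_map H \<omega>) \<omega> \<in> A} \<in> sets P" if [measurable]: "A \<in> sets P" for A
    by measurable
  then have "preserves_palm P \<theta> m \<gamma> w H \<longleftrightarrow>
      (\<forall>A\<in>sets P. emeasure (distr palm_measure P flow_back) A = emeasure palm_measure A)"
    unfolding preserves_palm_def by (intro ball_cong) (simp_all add: palm_prob_eq_iff em)
  also have "\<dots> \<longleftrightarrow> distr palm_measure P flow_back = palm_measure"
    by (auto intro: measure_eqI)
  finally show ?thesis .
qed

text \<open>
  With \<open>D \<omega> = \<Delta> (- point_map H \<omega>)\<close>, the change of variables says that \<open>flow_back\<close> maps the density \<open>D\<close> to the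
  Palm measure. If \<open>D = 1\<close>, this is invariance. Conversely, invariance alone would only make the
  average of \<open>D\<close> over the fibres of \<open>flow_back\<close> equal to \<open>1\<close>; but \<open>D\<close> is constant on these fibres, because it is
  \<open>incoming_modulus\<close> composed with \<open>flow_back\<close>.
\<close>

lemma palm_preserved_iff_isomodular:
  "distr palm_measure P flow_back = palm_measure \<longleftrightarrow> isomodular P \<Delta> m H"
proof
  interpret Q: finite_measure palm_measure by (rule finite_palm_measure)
  assume pres: "distr palm_measure P flow_back = palm_measure"
  \<comment> \<open>Invariance turns the integral of \<open>incoming_modulus\<close> over \<open>A\<close> into one of \<open>D\<close> over the preimage of \<open>A\<close>,
    which by the change of variables is the measure of \<open>A\<close>.\<close>
  have "density palm_measure incoming_modulus = density palm_measure (\<lambda>_. 1)"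
  proof (rule measure_eqI)
    fix A assume "A \<in> sets (density palm_measure incoming_modulus)"
    then have A[measurable]: "A \<in> sets P" by simp
    have "emeasure (density palm_measure incoming_modulus) A
        = (\<integral>\<^sup>+ \<omega>. indicator A \<omega> * incoming_modulus \<omega> \<partial>distr palm_measure P flow_back)"
      unfolding pres by (subst emeasure_density) (auto simp: mult.commute)
    also have "\<dots> = (\<integral>\<^sup>+ \<omega>. indicator A (flow_back \<omega>) * incoming_modulus (flow_back \<omega>) \<partial>palm_measure)"
      by (rule nn_integral_distr) measurable
    also have "\<dots> = (\<integral>\<^sup>+ \<omega>. indicator A (flow_back \<omega>) * ennreal (\<Delta> (- point_map H \<omega>)) \<partial>palm_measure)"
      using incoming_modulus_flow_back by (intro nn_integral_cong_AE) auto
    also have "\<dots> = (\<integral>\<^sup>+ \<omega>. indicator A \<omega> \<partial>palm_measure)"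
      by (rule palm_change_of_variables[symmetric]) measurable
    finally show "emeasure (density palm_measure incoming_modulus) A = emeasure (density palm_measure (\<lambda>_. 1)) A"
      by (simp add: density_1)
  qed simp
  then have "AE \<omega> in palm_measure. incoming_modulus \<omega> = 1"
    by (intro Q.density_unique) auto
  then have "AE \<omega> in distr palm_measure P flow_back. incoming_modulus \<omega> = 1"
    unfolding pres .
  then have "AE \<omega> in palm_measure. incoming_modulus (flow_back \<omega>) = 1"
    by (subst (asm) AE_distr_iff) auto
  with incoming_modulus_flow_back have "AE \<omega> in palm_measure. \<Delta> (- point_map H \<omega>) = 1"
    by eventually_elim simp
  then show "isomodular P \<Delta> m H" by (simp add: isomodular_iff_AE_palm)
next
  assume "isomodular P \<Delta> m H"
  then have one: "AE \<omega> in palm_measure. \<Delta> (- point_map H \<omega>) = 1"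
    by (simp add: isomodular_iff_AE_palm)
  show "distr palm_measure P flow_back = palm_measure"
  proof (rule measure_eqI)
    fix A assume "A \<in> sets (distr palm_measure P flow_back)"
    then have A[measurable]: "A \<in> sets P" by simp
    have "emeasure palm_measure A = (\<integral>\<^sup>+ \<omega>. indicator A \<omega> \<partial>palm_measure)" by simp
    also have "\<dots> = (\<integral>\<^sup>+ \<omega>. indicator A (flow_back \<omega>) * ennreal (\<Delta> (- point_map H \<omega>)) \<partial>palm_measure)"
      by (rule palm_change_of_variables) measurable
    also have "\<dots> = (\<integral>\<^sup>+ \<omega>. indicator A (flow_back \<omega>) \<partial>palm_measure)"
      using one by (intro nn_integral_cong_AE) auto
    also have "\<dots> = (\<integral>\<^sup>+ \<omega>. indicator A \<omega> \<partial>distr palm_measure P flow_back)"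
      by (rule nn_integral_distr[symmetric]) measurable
    finally show "emeasure (distr palm_measure P flow_back) A = emeasure palm_measure A" by simp
  qed simp
qed

end

theorem theorem4p5:
  fixes L :: "'x::{topological_group_add, second_countable_topology, t2_space} measure"
    and \<Delta> :: "'x \<Rightarrow> real"
    and P :: "'w measure"
    and \<theta> :: "'x \<Rightarrow> 'w \<Rightarrow> 'w"
    and m :: "'w \<Rightarrow> 'x measure"
    and \<gamma> :: ennreal
    and w :: "'x \<Rightarrow> real"
    and H :: "'w \<Rightarrow> 'x \<Rightarrow> 'x"
  assumes "locally compact (UNIV :: 'x set)"
    and "left_haar_measure L"
    and "modular_function L \<Delta>"
    and "stationary_framework P \<theta>"
    and "simple_point_process P m"
    and "flow_adapted_process P \<theta> m"
    and "has_intensity P L m \<gamma>" and "0 < \<gamma>" and "\<gamma> < \<infinity>"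
    and "w \<in> borel_measurable borel" and "\<And>x. 0 \<le> w x" and "(\<integral>\<^sup>+ x. ennreal (w x) \<partial>L) = 1"
    and "point_shift P \<theta> m H"
    and "bijective_shift P m H"
  shows "preserves_palm P \<theta> m \<gamma> w H \<longleftrightarrow> isomodular P \<Delta> m H"
proof -
  interpret bijective_point_shift L \<Delta> P \<theta> m \<gamma> w H
    using assms by unfold_locales
  show ?thesis using preserves_palm_iff palm_preserved_iff_isomodular by simp
qed

end
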